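(* There is an absolute constant $C_1>1$ such that for every fixed $k\ge 2$ there exist a constant $C(k)>0$ depending only on $k$, and constants $c,c',C,C'>0$ (depending only on $k$), such that the following holds for all integers $d,n\ge1$. Let $0<\alpha,\varepsilon\le 1$, put $L=\log\left(2+\frac{d}{\alpha\varepsilon}\right)$, and suppose $0\le\delta\le\tilde\Omega\left(\frac{\alpha\varepsilon}{d}\right)^{C_1}$, that is, $0\le \delta\le\left(\frac{c'}{L^{C'}}\cdot\frac{\alpha\varepsilon}{d}\right)^{C_1}$. Let $M$ be an $(\varepsilon,\delta)$-differentially private mechanism that takes as input $X=\{X_1,\dots,X_n\}$ with each $X_i\in\mathbb{R}^d$ and outputs a vector in $\mathbb{R}^d$. Suppose that for every distribution $\mathcal{D}$ on $\mathbb{R}^d$ with mean $\mu_{\mathcal D}=\mathbb{E}_{Y\sim\mathcal{D}}[Y]$ satisfying $\mathbb{E}_{Y\sim\mathcal{D}}\left[|\langle Y-\mu_{\mathcal D},v\rangle|^k\right]\le C(k)$ for all unit vectors $v\in\mathbb{R}^d$, if $X_1,\dots,X_n$ are drawn i.i.d. from $\mathcal{D}$, then with probability at least $2/3$ over the randomness of $M$ and $X_1,\dots,X_n$, $\|M(X)-\mu_{\mathcal D}\|_2\le\alpha$. Then $n\ge\tilde\Omega\left(\frac{d}{\alpha^2}+\frac{d}{\alpha^{k/(k-1)}\varepsilon}\right)$, that is, $$n\ \ge\ \frac{c}{L^{C}}\left(\frac{d}{\alpha^2}+\frac{d}{\alpha^{k/(k-1)}\cdot\varepsilon}\right).$$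
   Context: A randomized algorithm $M:\mathcal{X}^n\to\mathcal{O}$ is $(\varepsilon,\delta)$-differentially private if for any two datasets $\mathbf{X},\mathbf{X}'\in\mathcal{X}^n$ that differ in only a single data point and any (measurable) $O\subset\mathcal{O}$, $\mathbb{P}[M(\mathbf{X}')\in O]\le e^{\varepsilon}\,\mathbb{P}[M(\mathbf{X})\in O]+\delta$. *)

theory Defs
  imports "HOL-Probability.Probability"
begin

text \<open>
  The dimension \<open>d\<close> is quantified inside the statement, after constants that must not depend
  on it, so it cannot be a type. Points of \<open>R^d\<close> are the elements of \<open>{..<d} \<rightarrow>\<^sub>E UNIV\<close>,
  with the product (equivalently Borel) sigma-algebra.
\<close>

definition euclid :: "nat \<Rightarrow> (nat \<Rightarrow> real) measure" where
  "euclid d = (\<Pi>\<^sub>M i\<in>{..<d}. borel)"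

definition euclid_norm :: "nat \<Rightarrow> (nat \<Rightarrow> real) \<Rightarrow> real" where
  "euclid_norm d x = L2_set x {..<d}"

definition euclid_inner :: "nat \<Rightarrow> (nat \<Rightarrow> real) \<Rightarrow> (nat \<Rightarrow> real) \<Rightarrow> real" where
  "euclid_inner d x y = (\<Sum>i<d. x i * y i)"

definition has_mean :: "nat \<Rightarrow> (nat \<Rightarrow> real) measure \<Rightarrow> (nat \<Rightarrow> real) \<Rightarrow> bool" where
  "has_mean d D \<mu> \<longleftrightarrow> \<mu> \<in> space (euclid d) \<and>
     (\<forall>i<d. integrable D (\<lambda>y. y i) \<and> (\<integral>y. y i \<partial>D) = \<mu> i)"

text \<open>
  The moment is a nonnegative Lebesgue integral, so that an infinite moment does not count as
  bounded (the Bochner integral of a non-integrable function is 0).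
\<close>

definition moment_bounded ::
  "nat \<Rightarrow> real \<Rightarrow> real \<Rightarrow> (nat \<Rightarrow> real) measure \<Rightarrow> (nat \<Rightarrow> real) \<Rightarrow> bool" where
  "moment_bounded d k B D \<mu> \<longleftrightarrow>
     (\<forall>v\<in>space (euclid d). euclid_norm d v = 1 \<longrightarrow>
        (\<integral>\<^sup>+y. ennreal (\<bar>euclid_inner d (\<lambda>i. y i - \<mu> i) v\<bar> powr k) \<partial>D) \<le> ennreal B)"

definition datasets :: "nat \<Rightarrow> 'x measure \<Rightarrow> (nat \<Rightarrow> 'x) measure" where
  "datasets n S = (\<Pi>\<^sub>M i\<in>{..<n}. S)"

definition neighbouring :: "nat \<Rightarrow> (nat \<Rightarrow> 'x) \<Rightarrow> (nat \<Rightarrow> 'x) \<Rightarrow> bool" where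
  "neighbouring n X X' \<longleftrightarrow> card {i\<in>{..<n}. X i \<noteq> X' i} = 1"

text \<open>
  A randomized algorithm is a probability kernel: \<open>M X\<close> is the law of the output on the
  dataset \<open>X\<close>.
\<close>

definition randomized_algorithm ::
  "nat \<Rightarrow> 'x measure \<Rightarrow> 'o measure \<Rightarrow> ((nat \<Rightarrow> 'x) \<Rightarrow> 'o measure) \<Rightarrow> bool" where
  "randomized_algorithm n S T M \<longleftrightarrow> M \<in> datasets n S \<rightarrow>\<^sub>M prob_algebra T"

definition differentially_private ::
  "nat \<Rightarrow> 'x measure \<Rightarrow> 'o measure \<Rightarrow> real \<Rightarrow> real \<Rightarrow> ((nat \<Rightarrow> 'x) \<Rightarrow> 'o measure) \<Rightarrow> bool" where
  "differentially_private n S T \<epsilon> \<delta> M \<longleftrightarrow>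
     randomized_algorithm n S T M \<and>
     (\<forall>X\<in>space (datasets n S). \<forall>X'\<in>space (datasets n S). neighbouring n X X' \<longrightarrow>
        (\<forall>A\<in>sets T. measure (M X') A \<le> exp \<epsilon> * measure (M X) A + \<delta>))"

text \<open>
  The law of \<open>M(X)\<close> when the \<open>n\<close> entries of \<open>X\<close> are drawn i.i.d. from \<open>D\<close> and the
  internal randomness of \<open>M\<close> is independent of \<open>X\<close>.
\<close>

definition output_law ::
  "nat \<Rightarrow> 'x measure \<Rightarrow> ((nat \<Rightarrow> 'x) \<Rightarrow> 'o measure) \<Rightarrow> 'o measure" where
  "output_law n D M = datasets n D \<bind> M"

end

theory Submission
  imports Defs
begin

text \<open>
  Let a data point be \<open>0\<close> with probability \<open>1 - q\<close> and \<open>R z\<close> otherwise, where \<open>z\<close> has independent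
  random signs with mean vector \<open>m\<close>, and give the coordinates of \<open>m\<close> independent symmetric Beta
  priors of total variance about \<open>s\<^sup>2\<close>. Stein's identity for this prior equates the expected
  correlation of the (clipped) output with the summed scores of the data points to about
  \<open>d / s\<^sup>2\<close> times its correlation with \<open>m\<close>, and accuracy makes the latter at least of order
  \<open>\<alpha> s\<close>. Conversely, Cauchy-Schwarz bounds the correlation with the scores by
  \<open>O(\<alpha> sqrt (n q d))\<close>, and privacy, sample by sample, bounds it by \<open>O(\<alpha> n q \<epsilon>)\<close>. The choice
  \<open>q = 1\<close>, \<open>s = \<alpha>\<close> in the first bound gives \<open>d / \<alpha>\<^sup>2\<close>; the choice \<open>q = \<alpha> powr (k / (k - 1))\<close>,
  \<open>s = 1\<close> in the second gives the privacy term. No logarithmic factor is lost.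
\<close>

subsection \<open>Finite i.i.d. sampling\<close>

text \<open>Two regions of the prior are useless. There the correlation may drop to -8 \<alpha>
  times the norm of m. Both losses are charged to explicit terms, s / 36 and norm^2 / 18, whose
  prior means stay below the gain. The Beta density suits the sign model because 1 - p^2 vanishes at
  both ends, so no boundary term appears, and because it cancels the denominator of the score z / (1
  + p z), leaving the polynomial z - p. Clipping at a multiple of \<alpha> keeps the upper bounds
  proportional to \<alpha> although the output is arbitrary with probability 1/3. For s = 1 the mean
  must have size q R of order \<alpha> while q R^k stays bounded; up to a constant, \<alpha> powr (k
  / (k - 1)) is the smallest q that allows this, and a small q makes the privacy bound strong.
  Sampling labels from a finite set makes every expectation a finite sum, polynomial in m, so the
  prior integral passes through it by linearity.\<close>

definition iid_expect :: "'a set \<Rightarrow> ('a \<Rightarrow> real) \<Rightarrow> nat \<Rightarrow> ((nat \<Rightarrow> 'a) \<Rightarrow> real) \<Rightarrow> real" where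
  "iid_expect S w n F = (\<Sum>X\<in>PiE {..<n} (\<lambda>_. S). (\<Prod>i<n. w (X i)) * F X)"

lemma sum_PiE_insert:
  assumes "i \<notin> I"
  shows "(\<Sum>X\<in>PiE (insert i I) A. h X) = (\<Sum>x\<in>A i. \<Sum>Y\<in>PiE I A. h (Y(i := x)))"
proof -
  have inj: "inj_on (\<lambda>(y, g). g(i := y)) (A i \<times> PiE I A)"
    using inj_combinator[OF assms] by blast
  have "(\<Sum>X\<in>PiE (insert i I) A. h X) = (\<Sum>p\<in>A i \<times> PiE I A. h ((\<lambda>(y, g). g(i := y)) p))"
    unfolding PiE_insert_eq by (rule sum.reindex[OF inj, unfolded o_def])
  also have "\<dots> = (\<Sum>x\<in>A i. \<Sum>Y\<in>PiE I A. h (Y(i := x)))"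
    by (simp add: sum.cartesian_product case_prod_beta)
  finally show ?thesis .
qed

lemma iid_expect_sum:
  "iid_expect S w n (\<lambda>X. \<Sum>j\<in>J. F j X) = (\<Sum>j\<in>J. iid_expect S w n (F j))"
  unfolding iid_expect_def by (simp add: sum_distrib_left) (rule sum.swap)

lemma iid_expect_cmult: "iid_expect S w n (\<lambda>X. c * F X) = c * iid_expect S w n F"
  unfolding iid_expect_def by (simp add: sum_distrib_left mult_ac)

lemma iid_expect_add:
  "iid_expect S w n (\<lambda>X. F X + G X) = iid_expect S w n F + iid_expect S w n G"
  unfolding iid_expect_def by (simp add: distrib_left sum.distrib)

lemma iid_expect_mono:
  assumes "\<And>l. l \<in> S \<Longrightarrow> 0 \<le> w l" "\<And>X. X \<in> PiE {..<n} (\<lambda>_. S) \<Longrightarrow> F X \<le> G X"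
  shows "iid_expect S w n F \<le> iid_expect S w n G"
  unfolding iid_expect_def using assms
  by (intro sum_mono mult_left_mono prod_nonneg) (auto simp: PiE_iff)

lemma sum_prod_weights:
  fixes n :: nat
  assumes "finite S" "sum w S = 1"
  shows "(\<Sum>X\<in>PiE {..<n} (\<lambda>_. S). (\<Prod>i<n. w (X i))) = (1::real)"
proof -
  have "(\<Sum>X\<in>PiE {..<n} (\<lambda>_. S). (\<Prod>i<n. w (X i))) = (\<Prod>i<n. sum w S)"
    using assms(1) by (subst prod_sum_PiE[of "{..<n}" "\<lambda>_. S" "\<lambda>_. w"]) simp_all
  then show ?thesis using assms by simp
qed

lemma iid_expect_const:
  assumes "finite S" "sum w S = 1"
  shows "iid_expect S w n (\<lambda>_. c) = c"
  unfolding iid_expect_def using sum_prod_weights[OF assms, of n]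
  by (simp flip: sum_distrib_right)

text \<open>Entry \<open>i\<close> is replaced by a fresh independent copy. After splitting off
  coordinate \<open>i\<close>, its old value no longer occurs in the integrand and sums out with
  total weight 1.\<close>

lemma iid_expect_resample:
  assumes "finite S" "sum w S = 1" "i < n"
  shows "iid_expect S w n F = iid_expect S w n (\<lambda>X. \<Sum>l\<in>S. w l * F (X(i := l)))"
proof -
  define J where "J = {..<n} - {i}"
  have J: "{..<n} = insert i J" "i \<notin> J" "finite J" using assms by (auto simp: J_def)
  have pr: "(\<Prod>k<n. w ((Y(i := x)) k)) = w x * (\<Prod>k\<in>J. w (Y k))" for x Y
    unfolding J(1) using J(2,3) by (subst prod.insert) (auto intro!: arg_cong2[where f="(*)"] prod.cong)
  have ins: "(\<Sum>X\<in>PiE {..<n} (\<lambda>_. S). h X) = (\<Sum>x\<in>S. \<Sum>Y\<in>PiE J (\<lambda>_. S). h (Y(i := x)))"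
    for h :: "(nat \<Rightarrow> _) \<Rightarrow> real"
    unfolding J(1) by (rule sum_PiE_insert[OF J(2)])
  have "iid_expect S w n (\<lambda>X. \<Sum>l\<in>S. w l * F (X(i := l)))
      = (\<Sum>x\<in>S. \<Sum>Y\<in>PiE J (\<lambda>_. S). (w x * (\<Prod>k\<in>J. w (Y k))) * (\<Sum>l\<in>S. w l * F (Y(i := l))))"
    unfolding iid_expect_def ins pr by (simp only: fun_upd_upd)
  also have "\<dots> = (\<Sum>x\<in>S. w x * (\<Sum>Y\<in>PiE J (\<lambda>_. S). (\<Prod>k\<in>J. w (Y k)) * (\<Sum>l\<in>S. w l * F (Y(i := l)))))"
    by (simp add: sum_distrib_left mult_ac)
  also have "\<dots> = (\<Sum>Y\<in>PiE J (\<lambda>_. S). (\<Prod>k\<in>J. w (Y k)) * (\<Sum>l\<in>S. w l * F (Y(i := l))))"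
    using assms(2) by (simp flip: sum_distrib_right)
  also have "\<dots> = (\<Sum>Y\<in>PiE J (\<lambda>_. S). \<Sum>l\<in>S. (w l * (\<Prod>k\<in>J. w (Y k))) * F (Y(i := l)))"
    by (simp add: sum_distrib_left mult_ac)
  also have "\<dots> = (\<Sum>l\<in>S. \<Sum>Y\<in>PiE J (\<lambda>_. S). (w l * (\<Prod>k\<in>J. w (Y k))) * F (Y(i := l)))"
    by (rule sum.swap)
  also have "\<dots> = iid_expect S w n F"
    unfolding iid_expect_def ins pr ..
  finally show ?thesis by simp
qed

lemma iid_expect_component:
  assumes "finite S" "sum w S = 1" "i < n"
  shows "iid_expect S w n (\<lambda>X. g (X i)) = (\<Sum>l\<in>S. w l * g l)"
  by (subst iid_expect_resample[OF assms]) (simp add: iid_expect_const[OF assms(1,2)])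

text \<open>The variance about the weighted mean \<open>e\<close> is nonnegative.\<close>

lemma weighted_sum_le_sqrt:
  fixes w :: "'a \<Rightarrow> real"
  assumes "\<And>x. x \<in> A \<Longrightarrow> 0 \<le> w x" "sum w A = 1"
  shows "(\<Sum>x\<in>A. w x * f x) \<le> sqrt (\<Sum>x\<in>A. w x * (f x)\<^sup>2)"
proof -
  define e where "e = (\<Sum>x\<in>A. w x * f x)"
  have "0 \<le> (\<Sum>x\<in>A. w x * (f x - e)\<^sup>2)" using assms by (intro sum_nonneg) auto
  also have "\<dots> = (\<Sum>x\<in>A. w x * (f x)\<^sup>2 - 2 * e * (w x * f x) + e\<^sup>2 * w x)"
    by (intro sum.cong) (auto simp: power2_eq_square algebra_simps)
  also have "\<dots> = (\<Sum>x\<in>A. w x * (f x)\<^sup>2) - 2 * e * e + e\<^sup>2 * sum w A"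
    unfolding sum.distrib sum_subtractf sum_distrib_left[symmetric] e_def[symmetric] ..
  also have "\<dots> = (\<Sum>x\<in>A. w x * (f x)\<^sup>2) - e\<^sup>2"
    using assms(2) by (simp add: power2_eq_square)
  finally show ?thesis unfolding e_def[symmetric] by (intro real_le_rsqrt) simp
qed

lemma iid_expect_le_sqrt:
  assumes "finite S" "sum w S = 1" "\<And>l. l \<in> S \<Longrightarrow> 0 \<le> w l"
  shows "iid_expect S w n F \<le> sqrt (iid_expect S w n (\<lambda>X. (F X)\<^sup>2))"
  unfolding iid_expect_def using assms
  by (intro weighted_sum_le_sqrt sum_prod_weights prod_nonneg) (auto simp: PiE_iff)

text \<open>Variances of independent centred terms add: resampling entry \<open>i\<close> in a cross
  term produces the factor \<open>\<Sum>l\<in>S. w l * g l\<close>, which is 0.\<close>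

lemma iid_expect_square_sum:
  assumes "finite S" "sum w S = 1" and 0: "(\<Sum>l\<in>S. w l * g l) = 0"
  shows "iid_expect S w n (\<lambda>X. (\<Sum>i<n. g (X i))\<^sup>2) = n * (\<Sum>l\<in>S. w l * (g l)\<^sup>2)"
proof -
  have cross: "iid_expect S w n (\<lambda>X. g (X i) * g (X j)) = (if i = j then \<Sum>l\<in>S. w l * (g l)\<^sup>2 else 0)"
    if "i < n" "j < n" for i j
  proof (cases "i = j")
    case True
    then show ?thesis using iid_expect_component[OF assms(1,2) \<open>i < n\<close>, of "\<lambda>l. g l * g l"]
      by (simp add: power2_eq_square)
  next
    case False
    have "iid_expect S w n (\<lambda>X. g (X i) * g (X j)) = iid_expect S w n (\<lambda>X. \<Sum>l\<in>S. w l * (g l * g (X j)))"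
      using False by (subst iid_expect_resample[OF assms(1,2) \<open>i < n\<close>]) simp
    also have "\<dots> = iid_expect S w n (\<lambda>X. (\<Sum>l\<in>S. w l * g l) * g (X j))"
      by (simp add: sum_distrib_right mult.assoc)
    finally show ?thesis using False by (simp add: 0 iid_expect_const[OF assms(1,2)])
  qed
  have "iid_expect S w n (\<lambda>X. (\<Sum>i<n. g (X i))\<^sup>2)
      = (\<Sum>i<n. \<Sum>j<n. iid_expect S w n (\<lambda>X. g (X i) * g (X j)))"
    by (simp add: power2_eq_square sum_product iid_expect_sum)
  also have "\<dots> = (\<Sum>i<n. \<Sum>j<n. if i = j then \<Sum>l\<in>S. w l * (g l)\<^sup>2 else 0)"
    by (intro sum.cong refl cross) auto
  finally show ?thesis by simp
qed

text \<open>The bridge from i.i.d. sampling in the sense of measures to \<open>iid_expect\<close>: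
  both sides agree on boxes, because the preimage of a box under a coordinatewise map is again a box
  of labels. The map \<open>g\<close> may identify labels.\<close>

lemma PiM_distr_point_measure:
  fixes w :: "'a \<Rightarrow> real" and n :: nat
  assumes S: "finite S" and w0: "\<And>l. l \<in> S \<Longrightarrow> 0 \<le> w l" and w1: "sum w S = 1"
    and g: "g \<in> S \<rightarrow> space N"
  shows "PiM {..<n} (\<lambda>_. distr (point_measure S (\<lambda>l. ennreal (w l))) N g)
    = distr (point_measure (PiE {..<n} (\<lambda>_. S)) (\<lambda>X. ennreal (\<Prod>i<n. w (X i))))
        (PiM {..<n} (\<lambda>_. N)) (\<lambda>X. \<lambda>i\<in>{..<n}. g (X i))"
proof -
  let ?D = "distr (point_measure S (\<lambda>l. ennreal (w l))) N g"
  have "(\<Sum>l\<in>S. ennreal (w l)) = 1" using w0 w1 by (simp add: sum_ennreal)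
  then interpret S: prob_space "point_measure S (\<lambda>l. ennreal (w l))"
    by (intro prob_space_point_measure S) auto
  have "prob_space ?D" using g by (intro S.prob_space_distr) auto
  then interpret product_prob_space "\<lambda>_::nat. ?D" by (intro product_prob_spaceI)
  have fin: "finite (PiE {..<n} (\<lambda>_. S))" using S by (intro finite_PiE) auto
  show ?thesis
  proof (rule PiM_eqI[symmetric])
    fix A :: "nat \<Rightarrow> _" assume A: "\<And>i. i \<in> {..<n} \<Longrightarrow> A i \<in> sets ?D"
    define B where "B i = {l \<in> S. g l \<in> A i}" for i
    have em: "emeasure ?D (A i) = ennreal (\<Sum>l\<in>B i. w l)" if "i < n" for i
    proof -
      have "g -` A i \<inter> S = B i" by (auto simp: B_def)
      then have "emeasure ?D (A i) = (\<Sum>l\<in>B i. ennreal (w l))"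
        using A[of i] that g S
        by (subst emeasure_distr)
          (auto simp: emeasure_point_measure_finite space_point_measure B_def)
      then show ?thesis using w0 by (subst (asm) sum_ennreal) (auto simp: B_def)
    qed
    have pre: "(\<lambda>X. \<lambda>i\<in>{..<n}. g (X i)) -` (PiE {..<n} A) \<inter> (PiE {..<n} (\<lambda>_. S)) = PiE {..<n} B"
    proof (rule set_eqI)
      fix X
      have "X \<in> (\<lambda>X. \<lambda>i\<in>{..<n}. g (X i)) -` (PiE {..<n} A) \<inter> (PiE {..<n} (\<lambda>_. S))
          \<longleftrightarrow> (\<forall>i\<in>{..<n}. g (X i) \<in> A i) \<and> X \<in> PiE {..<n} (\<lambda>_. S)"
        by (simp only: Int_iff vimage_eq restrict_PiE_iff)
      also have "\<dots> \<longleftrightarrow> X \<in> PiE {..<n} B"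
        by (simp only: PiE_iff B_def mem_Collect_eq) blast
      finally show "X \<in> (\<lambda>X. \<lambda>i\<in>{..<n}. g (X i)) -` (PiE {..<n} A) \<inter> (PiE {..<n} (\<lambda>_. S))
          \<longleftrightarrow> X \<in> PiE {..<n} B" .
    qed
    have "emeasure (distr (point_measure (PiE {..<n} (\<lambda>_. S)) (\<lambda>X. ennreal (\<Prod>i<n. w (X i))))
        (PiM {..<n} (\<lambda>_. N)) (\<lambda>X. \<lambda>i\<in>{..<n}. g (X i))) (PiE {..<n} A)
      = (\<Sum>X\<in>PiE {..<n} B. ennreal (\<Prod>i<n. w (X i)))"
    proof (subst emeasure_distr)
      show "PiE {..<n} A \<in> sets (PiM {..<n} (\<lambda>_. N))"
        using A by (intro sets_PiM_I_finite) auto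
      show "(\<lambda>X. \<lambda>i\<in>{..<n}. g (X i)) \<in> point_measure (PiE {..<n} (\<lambda>_. S)) (\<lambda>X. ennreal (\<Prod>i<n. w (X i)))
          \<rightarrow>\<^sub>M PiM {..<n} (\<lambda>_. N)"
        using g by (auto simp: space_PiM PiE_iff)
      have "PiE {..<n} B \<subseteq> PiE {..<n} (\<lambda>_. S)" unfolding B_def by (intro PiE_mono) auto
      then show "emeasure (point_measure (PiE {..<n} (\<lambda>_. S)) (\<lambda>X. ennreal (\<Prod>i<n. w (X i))))
         ((\<lambda>X. \<lambda>i\<in>{..<n}. g (X i)) -` (PiE {..<n} A) \<inter>
          space (point_measure (PiE {..<n} (\<lambda>_. S)) (\<lambda>X. ennreal (\<Prod>i<n. w (X i)))))
         = (\<Sum>X\<in>PiE {..<n} B. ennreal (\<Prod>i<n. w (X i)))"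
        by (simp add: space_point_measure pre emeasure_point_measure_finite fin)
    qed
    also have "\<dots> = ennreal (\<Sum>X\<in>PiE {..<n} B. \<Prod>i<n. w (X i))"
      using w0 by (intro sum_ennreal prod_nonneg) (auto simp: B_def PiE_iff)
    also have "(\<Sum>X\<in>PiE {..<n} B. \<Prod>i<n. w (X i)) = (\<Prod>i<n. \<Sum>l\<in>B i. w l)"
      using S by (intro prod_sum_PiE[symmetric]) (auto simp: B_def)
    also have "ennreal \<dots> = (\<Prod>i<n. ennreal (\<Sum>l\<in>B i. w l))"
      using w0 by (intro prod_ennreal[symmetric] sum_nonneg) (auto simp: B_def)
    also have "\<dots> = (\<Prod>i\<in>{..<n}. emeasure ?D (A i))"
      by (intro prod.cong refl em[symmetric]) auto
    finally show "emeasure (distr (point_measure (PiE {..<n} (\<lambda>_. S)) (\<lambda>X. ennreal (\<Prod>i<n. w (X i))))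
        (PiM {..<n} (\<lambda>_. N)) (\<lambda>X. \<lambda>i\<in>{..<n}. g (X i))) (PiE {..<n} A) = (\<Prod>i\<in>{..<n}. emeasure ?D (A i))" .
  qed (auto intro!: sets_PiM_cong)
qed

subsection \<open>Privacy for expectations\<close>

text \<open>A discrete layer-cake argument: up to 1 / N, \<phi> is the average of N indicators of
  superlevel sets. The hypothesis applies to each of them, and averaging keeps the additive \<delta>
  instead of accumulating it.\<close>

lemma integral_le_of_measure_le:
  fixes \<phi> :: "'a \<Rightarrow> real"
  assumes "prob_space P" "prob_space Q" and sP: "sets P = sets T" and sQ: "sets Q = sets T"
    and PQ: "\<And>A. A \<in> sets T \<Longrightarrow> measure P A \<le> c * measure Q A + \<delta>"
    and [measurable]: "\<phi> \<in> borel_measurable T"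
    and \<phi>: "\<And>y. y \<in> space T \<Longrightarrow> 0 \<le> \<phi> y \<and> \<phi> y \<le> 1" and c: "0 \<le> c"
  shows "(\<integral>y. \<phi> y \<partial>P) \<le> c * (\<integral>y. \<phi> y \<partial>Q) + \<delta>"
proof (rule field_le_epsilon)
  interpret P: prob_space P by fact
  interpret Q: prob_space Q by fact
  note [measurable_cong] = sP sQ
  have spP: "space P = space T" and spQ: "space Q = space T"
    using sP sQ by (auto dest: sets_eq_imp_space_eq)
  fix e :: real assume "0 < e"
  then obtain N :: nat where N: "inverse (real N) < e" "N > 0"
    using reals_Archimedean[of e] by blast
  \<comment> \<open>On \<open>space T\<close> the sum \<open>g\<close> of the indicators of these
    sets is the floor of N * \<phi>, since \<phi> takes values in [0, 1].\<close>
  define A where "A k = {y \<in> space T. real k \<le> N * \<phi> y}" for k :: nat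
  have [measurable]: "A k \<in> sets T" for k unfolding A_def by measurable
  define g where "g y = (\<Sum>k=1..N. indicator (A k) y :: real)" for y
  have g: "N * \<phi> y - 1 \<le> g y \<and> g y \<le> N * \<phi> y" if "y \<in> space T" for y
  proof -
    define m where "m = nat \<lfloor>N * \<phi> y\<rfloor>"
    have "0 \<le> N * \<phi> y" "N * \<phi> y \<le> N" using \<phi>[OF that] by (auto intro: mult_left_le)
    then have m: "real m \<le> N * \<phi> y" "N * \<phi> y < real m + 1" "m \<le> N" unfolding m_def by linarith+
    have iff: "real k \<le> N * \<phi> y \<longleftrightarrow> k \<le> m" for k using m by linarith
    have "g y = (\<Sum>k=1..N. if k \<le> m then 1 else 0)"
      unfolding g_def A_def using that by (intro sum.cong) (auto simp: indicator_def iff)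
    also have "\<dots> = real (card ({1..N} \<inter> {k. k \<le> m}))"
      by (simp add: sum.If_cases)
    also have "{1..N} \<inter> {k. k \<le> m} = {1..m}" using m(3) by auto
    finally show ?thesis using m by simp
  qed
  have intg: "(\<integral>y. g y \<partial>P) = (\<Sum>k=1..N. measure P (A k))" "(\<integral>y. g y \<partial>Q) = (\<Sum>k=1..N. measure Q (A k))"
    unfolding g_def by (subst Bochner_Integration.integral_sum; simp add: P.emeasure_eq_measure Q.emeasure_eq_measure)+
  have ig: "integrable P g" "integrable Q g"
    unfolding g_def by (auto simp: P.emeasure_eq_measure Q.emeasure_eq_measure)
  have i\<phi>: "integrable P \<phi>" "integrable Q \<phi>"
    using \<phi> by (auto intro!: P.integrable_const_bound[where B=1] Q.integrable_const_bound[where B=1] AE_I2 simp: spP spQ)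
  have "N * (\<integral>y. \<phi> y \<partial>P) - 1 = (\<integral>y. N * \<phi> y - 1 \<partial>P)"
    using i\<phi> by (simp add: P.prob_space)
  also have "\<dots> \<le> (\<integral>y. g y \<partial>P)"
    using g i\<phi> ig by (intro integral_mono) (auto simp: spP)
  also have "\<dots> \<le> (\<Sum>k=1..N. c * measure Q (A k) + \<delta>)"
    unfolding intg by (intro sum_mono PQ) auto
  also have "\<dots> = c * (\<integral>y. g y \<partial>Q) + N * \<delta>"
    by (simp add: intg sum.distrib sum_distrib_left)
  also have "(\<integral>y. g y \<partial>Q) \<le> (\<integral>y. N * \<phi> y \<partial>Q)"
    using g i\<phi> ig by (intro integral_mono) (auto simp: spQ)
  also have "(\<integral>y. N * \<phi> y \<partial>Q) = N * (\<integral>y. \<phi> y \<partial>Q)" by simp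
  finally have "N * (\<integral>y. \<phi> y \<partial>P) - 1 \<le> c * (N * (\<integral>y. \<phi> y \<partial>Q)) + N * \<delta>"
    using c by (simp add: mult_left_mono)
  then have "(\<integral>y. \<phi> y \<partial>P) \<le> (c * (N * (\<integral>y. \<phi> y \<partial>Q)) + N * \<delta> + 1) / N"
    using N(2) by (simp add: field_simps)
  also have "\<dots> = c * (\<integral>y. \<phi> y \<partial>Q) + \<delta> + inverse N"
    using N(2) by (simp add: field_simps)
  finally show "(\<integral>y. \<phi> y \<partial>P) \<le> c * (\<integral>y. \<phi> y \<partial>Q) + \<delta> + e" using N(1) by linarith
qed

text \<open>Positive and negative parts are treated separately: the positive part must not grow,
  which uses the bound of P by Q, and the negative part must not shrink, which uses the bound of Q
  by P. The error is measured by the mean of the absolute value under Q, not by the supremum; the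
  supremum \<open>B\<close> is paid only against \<delta>.\<close>

lemma dp_integral_le:
  fixes \<phi> :: "'a \<Rightarrow> real"
  assumes P: "prob_space P" and Q: "prob_space Q" and sP: "sets P = sets T" and sQ: "sets Q = sets T"
    and PQ: "\<And>A. A \<in> sets T \<Longrightarrow> measure P A \<le> exp \<epsilon> * measure Q A + \<delta>"
    and QP: "\<And>A. A \<in> sets T \<Longrightarrow> measure Q A \<le> exp \<epsilon> * measure P A + \<delta>"
    and m[measurable]: "\<phi> \<in> borel_measurable T"
    and \<phi>: "\<And>y. y \<in> space T \<Longrightarrow> \<bar>\<phi> y\<bar> \<le> B" and "0 \<le> \<epsilon>" "0 \<le> \<delta>"
  shows "(\<integral>y. \<phi> y \<partial>P) \<le> (\<integral>y. \<phi> y \<partial>Q) + (exp \<epsilon> - 1) * (\<integral>y. \<bar>\<phi> y\<bar> \<partial>Q) + 2 * B * \<delta>"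
proof -
  interpret P: prob_space P by fact
  interpret Q: prob_space Q by fact
  note [measurable_cong] = sP sQ
  have spP: "space P = space T" and spQ: "space Q = space T"
    using sP sQ by (auto dest: sets_eq_imp_space_eq)
  have B: "0 \<le> B" using \<phi> P.not_empty unfolding spP by (metis abs_ge_zero all_not_in_conv order_trans)
  show ?thesis
  proof (cases "B = 0")
    case True
    have "(\<integral>y. \<phi> y \<partial>P) = (\<integral>y. 0 \<partial>P)" "(\<integral>y. \<phi> y \<partial>Q) = (\<integral>y. 0 \<partial>Q)" "(\<integral>y. \<bar>\<phi> y\<bar> \<partial>Q) = (\<integral>y. 0 \<partial>Q)"
      using \<phi> True by (intro Bochner_Integration.integral_cong; simp add: spP spQ)+
    then show ?thesis using True by simp
  next
    case False
    with B have B: "0 < B" by simp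
    define p where "p y = max 0 (\<phi> y) / B" for y
    define m where "m y = max 0 (- \<phi> y) / B" for y
    have [measurable]: "p \<in> borel_measurable T" "m \<in> borel_measurable T"
      unfolding p_def m_def by measurable
    have b: "0 \<le> p y \<and> p y \<le> 1" "0 \<le> m y \<and> m y \<le> 1" if "y \<in> space T" for y
      using \<phi>[OF that] B by (auto simp: p_def m_def abs_le_iff divide_simps)
    have int: "integrable P p" "integrable Q p" "integrable P m" "integrable Q m"
      using b by (auto intro!: P.integrable_const_bound[where B=1] Q.integrable_const_bound[where B=1] AE_I2 simp: spP spQ)
    have \<phi>eq: "\<phi> = (\<lambda>y. B * p y - B * m y)" and abs: "(\<lambda>y. \<bar>\<phi> y\<bar>) = (\<lambda>y. B * p y + B * m y)"
      using B by (auto simp: p_def m_def fun_eq_iff max_def)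
    define Pp Qp Pm Qm where "Pp = (\<integral>y. p y \<partial>P)" "Qp = (\<integral>y. p y \<partial>Q)" "Pm = (\<integral>y. m y \<partial>P)" "Qm = (\<integral>y. m y \<partial>Q)"
    note D = Pp_Qp_Pm_Qm_def
    have "Pp \<le> exp \<epsilon> * Qp + \<delta>" unfolding D
      by (rule integral_le_of_measure_le[OF P Q sP sQ PQ]) (use b in auto)
    moreover have "Qm \<le> exp \<epsilon> * Pm + \<delta>" unfolding D
      by (rule integral_le_of_measure_le[OF Q P sQ sP QP]) (use b in auto)
    then have "exp (- \<epsilon>) * Qm \<le> exp (- \<epsilon>) * (exp \<epsilon> * Pm + \<delta>)" by (intro mult_left_mono) auto
    then have "exp (- \<epsilon>) * Qm \<le> Pm + exp (- \<epsilon>) * \<delta>"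
      by (simp add: distrib_left mult_exp_exp flip: mult.assoc)
    moreover have "exp (- \<epsilon>) * \<delta> \<le> \<delta>" using assms by (auto intro!: mult_left_le_one_le)
    \<comment> \<open>Replacing exp (- \<epsilon>) by the smaller 2 - exp \<epsilon> gives the
      negative part the same error factor exp \<epsilon> - 1 as the positive part.\<close>
    moreover have "(2 - exp \<epsilon>) * Qm \<le> exp (- \<epsilon>) * Qm"
    proof (rule mult_right_mono)
      have "1 + \<epsilon> \<le> exp \<epsilon>" "1 + - \<epsilon> \<le> exp (- \<epsilon>)" by (rule exp_ge_add_one_self)+
      then show "2 - exp \<epsilon> \<le> exp (- \<epsilon>)" by linarith
      show "0 \<le> Qm" unfolding D using b by (intro Bochner_Integration.integral_nonneg) (auto simp: spQ)
    qed
    ultimately have "Pp - Pm \<le> Qp - Qm + (exp \<epsilon> - 1) * (Qp + Qm) + 2 * \<delta>"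
      by (simp add: algebra_simps)
    then have "B * (Pp - Pm) \<le> B * (Qp - Qm + (exp \<epsilon> - 1) * (Qp + Qm) + 2 * \<delta>)"
      using B by (intro mult_left_mono) auto
    moreover have "(\<integral>y. \<phi> y \<partial>P) = B * (Pp - Pm)" "(\<integral>y. \<phi> y \<partial>Q) = B * (Qp - Qm)"
      unfolding \<phi>eq D using int by (simp_all add: right_diff_distrib)
    moreover have "(\<integral>y. \<bar>\<phi> y\<bar> \<partial>Q) = B * (Qp + Qm)"
      unfolding abs D using int by (simp add: distrib_left)
    ultimately show ?thesis by (simp add: algebra_simps)
  qed
qed

subsection \<open>Radial clipping\<close>

text \<open>Radial projection onto the ball of radius \<rho>. For norm 0 the quotient is 0, so the
  factor is 0 rather than 1; this is harmless, since then all coordinates below \<open>d\<close>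
  vanish.\<close>

definition clip :: "nat \<Rightarrow> real \<Rightarrow> (nat \<Rightarrow> real) \<Rightarrow> nat \<Rightarrow> real" where
  "clip d \<rho> y j = y j * min 1 (\<rho> / euclid_norm d y)"

lemma euclid_norm_nonneg: "0 \<le> euclid_norm d y"
  by (simp add: euclid_norm_def)

lemma euclid_norm_square: "(euclid_norm d y)\<^sup>2 = (\<Sum>i<d. (y i)\<^sup>2)"
  by (simp add: euclid_norm_def L2_set_def sum_nonneg)

lemma euclid_inner_le: "\<bar>euclid_inner d x y\<bar> \<le> euclid_norm d x * euclid_norm d y"
proof -
  have "\<bar>euclid_inner d x y\<bar> \<le> (\<Sum>i<d. \<bar>x i\<bar> * \<bar>y i\<bar>)"
    unfolding euclid_inner_def by (rule order_trans[OF sum_abs]) (simp add: abs_mult)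
  also have "\<dots> \<le> euclid_norm d x * euclid_norm d y"
    unfolding euclid_norm_def by (rule L2_set_mult_ineq)
  finally show ?thesis .
qed

lemma euclid_norm_scale: "euclid_norm d (\<lambda>i. c * y i) = \<bar>c\<bar> * euclid_norm d y"
  unfolding euclid_norm_def L2_set_def
  by (simp add: power_mult_distrib real_sqrt_mult flip: sum_distrib_left)

lemma euclid_norm_triangle: "euclid_norm d (\<lambda>i. x i + y i) \<le> euclid_norm d x + euclid_norm d y"
  unfolding euclid_norm_def by (rule L2_set_triangle_ineq)

lemma euclid_inner_clip:
  "euclid_inner d (clip d \<rho> y) v = euclid_inner d y v * min 1 (\<rho> / euclid_norm d y)"
  unfolding euclid_inner_def clip_def by (simp add: sum_distrib_left mult_ac)

lemma euclid_norm_clip: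
  assumes "0 \<le> \<rho>"
  shows "euclid_norm d (clip d \<rho> y) \<le> \<rho>"
proof -
  let ?t = "min 1 (\<rho> / euclid_norm d y)"
  have t: "0 \<le> ?t" using assms euclid_norm_nonneg[of d y] by auto
  have "euclid_norm d (clip d \<rho> y) = euclid_norm d y * ?t"
    using euclid_norm_scale[of d ?t y] t by (simp add: clip_def[abs_def] mult_ac)
  also have "\<dots> \<le> \<rho>"
  proof (cases "euclid_norm d y = 0")
    case False
    then have "0 < euclid_norm d y" using euclid_norm_nonneg[of d y] by simp
    then have "euclid_norm d y * ?t \<le> euclid_norm d y * (\<rho> / euclid_norm d y)"
      by (intro mult_left_mono) auto
    then show ?thesis using False by simp
  qed (use assms in auto)
  finally show ?thesis .
qed

lemma measurable_euclid_component [measurable]: "j < d \<Longrightarrow> (\<lambda>y. y j) \<in> borel_measurable (euclid d)"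
  unfolding euclid_def by measurable

lemma measurable_euclid_norm [measurable]:
  "euclid_norm d \<in> borel_measurable (euclid d)"
  "(\<lambda>y. euclid_norm d (\<lambda>i. y i - \<mu> i)) \<in> borel_measurable (euclid d)"
  unfolding euclid_norm_def L2_set_def by measurable

lemma measurable_clip [measurable]:
  "j < d \<Longrightarrow> (\<lambda>y. clip d \<rho> y j) \<in> borel_measurable (euclid d)"
  unfolding clip_def by measurable

lemma measurable_inner_clip [measurable]:
  "(\<lambda>y. euclid_inner d (clip d \<rho> y) v) \<in> borel_measurable (euclid d)"
  unfolding euclid_inner_def by measurable

lemma abs_inner_clip_le:
  "0 \<le> \<rho> \<Longrightarrow> \<bar>euclid_inner d (clip d \<rho> y) v\<bar> \<le> \<rho> * euclid_norm d v"
  using euclid_inner_le[of d "clip d \<rho> y" v] euclid_norm_clip[of \<rho> d y] euclid_norm_nonneg[of d v]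
  by (meson mult_right_mono order_trans)

text \<open>Accuracy \<open>\<alpha>\<close> and clipping radius \<open>8 \<alpha>\<close> leave a correlation of at least \<open>6 \<alpha>\<close> with the
  direction of \<open>\<mu>\<close>, which outweighs the \<open>8 \<alpha>\<close> that can be lost with probability \<open>1/3\<close>.\<close>

lemma inner_clip_lower:
  assumes acc: "euclid_norm d (\<lambda>i. y i - \<mu> i) \<le> \<alpha>" and far: "8 * \<alpha> \<le> euclid_norm d \<mu>" and \<alpha>: "0 < \<alpha>"
  shows "6 * \<alpha> * euclid_norm d \<mu> \<le> euclid_inner d (clip d (8 * \<alpha>) y) \<mu>"
proof -
  define u t where "u = euclid_norm d \<mu>" "t = euclid_norm d y"
  note D = u_t_def
  have u: "8 * \<alpha> \<le> u" using far by (simp add: D)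
  have "euclid_inner d y \<mu> = u\<^sup>2 + euclid_inner d (\<lambda>i. y i - \<mu> i) \<mu>"
    unfolding D euclid_norm_square euclid_inner_def
    by (simp add: algebra_simps power2_eq_square flip: sum.distrib)
  moreover have "\<bar>euclid_inner d (\<lambda>i. y i - \<mu> i) \<mu>\<bar> \<le> \<alpha> * u"
    unfolding D using acc by (meson euclid_inner_le euclid_norm_nonneg mult_right_mono order_trans)
  ultimately have in1: "u * (u - \<alpha>) \<le> euclid_inner d y \<mu>"
    by (auto simp: power2_eq_square algebra_simps abs_le_iff)
  have tu: "t \<le> u + \<alpha>"
    using euclid_norm_triangle[of d "\<lambda>i. y i - \<mu> i" \<mu>] acc by (simp add: D)
  have 7: "7 * \<alpha> * u \<le> u * (u - \<alpha>)" using mult_left_mono[of "7 * \<alpha>" "u - \<alpha>" u] u \<alpha> by (simp add: mult_ac)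
  show ?thesis
  proof (cases "t \<le> 8 * \<alpha>")
    case True
    have "min 1 (8 * \<alpha> / t) = 1 \<or> t = 0"
      using True euclid_norm_nonneg[of d y] by (auto simp: D min_def field_simps)
    \<comment> \<open>Norm 0 must be excluded because the clipping factor is 0 there. It would force
      a nonpositive inner product, against the lower bound \<open>7 * \<alpha> * u\<close>.\<close>
    moreover have "t \<noteq> 0"
    proof
      assume "t = 0"
      then have "euclid_inner d y \<mu> \<le> 0" using euclid_inner_le[of d y \<mu>] by (simp add: D)
      moreover have "0 < 7 * \<alpha> * u" using u \<alpha> by simp
      ultimately show False using in1 7 by linarith
    qed
    moreover have "6 * \<alpha> * u \<le> 7 * \<alpha> * u" using u \<alpha> by simp
    ultimately show ?thesis unfolding euclid_inner_clip D[symmetric] using in1 7 by auto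
  next
    case False
    then have t: "t > 8 * \<alpha>" by simp
    then have "min 1 (8 * \<alpha> / t) = 8 * \<alpha> / t" using \<alpha> by (auto simp: min_def field_simps)
    moreover have "6 * \<alpha> * u \<le> (u * (u - \<alpha>)) * (8 * \<alpha> / t)"
    proof -
      \<comment> \<open>The comparison of \<open>6 * (u + \<alpha>)\<close> with
        \<open>8 * (u - \<alpha>)\<close> amounts to \<open>7 * \<alpha> \<le> u\<close>; the
        hypothesis \<open>far\<close> provides it.\<close>
      have "6 * t \<le> 6 * (u + \<alpha>)" using tu by simp
      also have "\<dots> \<le> 8 * (u - \<alpha>)" using u \<alpha> by simp
      finally have "6 * t \<le> 8 * (u - \<alpha>)" .
      then have "(\<alpha> * u) * (6 * t) \<le> (\<alpha> * u) * (8 * (u - \<alpha>))" using u \<alpha> by (intro mult_left_mono) auto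
      moreover have "0 < t" using t \<alpha> by linarith
      ultimately show ?thesis by (simp add: field_simps)
    qed
    moreover have "(u * (u - \<alpha>)) * (8 * \<alpha> / t) \<le> euclid_inner d y \<mu> * (8 * \<alpha> / t)"
      using in1 t \<alpha> by (intro mult_right_mono) auto
    ultimately show ?thesis unfolding euclid_inner_clip D[symmetric] by auto
  qed
qed

subsection \<open>The symmetric Beta prior\<close>

text \<open>The unnormalised density of the Beta(c + 1, c + 1) law, moved affinely from [0, 1] to
  [-1, 1].\<close>

definition beta_weight :: "nat \<Rightarrow> real \<Rightarrow> real" where
  "beta_weight c p = (1 - p\<^sup>2) ^ c * indicator {-1..1} p"

definition beta_prior :: "nat \<Rightarrow> real measure" where
  "beta_prior c = density lborel (\<lambda>p. ennreal (beta_weight c p / (\<integral>x. beta_weight c x \<partial>lborel)))"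

lemma beta_weight_nonneg: "0 \<le> beta_weight c p"
  unfolding beta_weight_def by (cases "p \<in> {-1..1}") (auto simp: abs_square_le_1 abs_le_iff)

lemma beta_weight_measurable [measurable]: "beta_weight c \<in> borel_measurable borel"
  unfolding beta_weight_def by measurable

lemma integrable_mult_beta_weight:
  assumes "continuous_on UNIV f"
  shows "integrable lborel (\<lambda>p. f p * beta_weight c p)"
proof -
  have "continuous_on {-1..1} (\<lambda>p. f p * (1 - p\<^sup>2) ^ c)"
    using assms by (intro continuous_intros) (auto intro: continuous_on_subset)
  then have "set_integrable lborel {-1..1} (\<lambda>p. f p * (1 - p\<^sup>2) ^ c)"
    by (rule borel_integrable_atLeastAtMost')
  then show ?thesis by (simp add: set_integrable_def beta_weight_def mult_ac)
qed

lemma integral_beta_weight_pos: "0 < (\<integral>x. beta_weight c x \<partial>lborel)"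
proof -
  have "0 < (\<integral>x. (3/4) ^ c * indicator {-1/2..1/2::real} x \<partial>lborel :: real)" by simp
  also have "\<dots> \<le> (\<integral>x. beta_weight c x \<partial>lborel)"
  proof (rule integral_mono)
    show "integrable lborel (beta_weight c)" using integrable_mult_beta_weight[of "\<lambda>_. 1"] by simp
    show "(3/4) ^ c * indicator {-1/2..1/2} x \<le> beta_weight c x" for x :: real
    proof (cases "x \<in> {-1/2..1/2}")
      case True
      then have "x\<^sup>2 \<le> (1/2)\<^sup>2" by (intro abs_le_square_iff[THEN iffD1]) auto
      then have "(3/4) ^ c \<le> (1 - x\<^sup>2) ^ c" by (intro power_mono) (auto simp: power2_eq_square)
      then show ?thesis using True by (auto simp: beta_weight_def)
    qed (simp add: beta_weight_nonneg)
  qed simp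
  finally show ?thesis .
qed

lemma sets_beta_prior [measurable_cong, simp]: "sets (beta_prior c) = sets borel"
  by (simp add: beta_prior_def)

lemma space_beta_prior [simp]: "space (beta_prior c) = UNIV"
  by (simp add: beta_prior_def)

lemma integral_beta_prior:
  assumes "continuous_on UNIV f"
  shows "integrable (beta_prior c) f"
    and "(\<integral>p. f p \<partial>beta_prior c) = (\<integral>p. f p * beta_weight c p \<partial>lborel) / (\<integral>x. beta_weight c x \<partial>lborel)"
proof -
  have f[measurable]: "f \<in> borel_measurable borel" using assms by (rule borel_measurable_continuous_onI)
  let ?Z = "\<integral>x. beta_weight c x \<partial>lborel"
  have nn: "0 \<le> beta_weight c p / ?Z" for p
    using beta_weight_nonneg integral_beta_weight_pos[of c] by simp
  have "integrable lborel (\<lambda>p. (1 / ?Z) * (f p * beta_weight c p))"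
    using integrable_mult_beta_weight[OF assms] by (intro integrable_mult_right) auto
  then show "integrable (beta_prior c) f"
    unfolding beta_prior_def using nn by (subst integrable_real_density) (auto simp: mult_ac)
  show "(\<integral>p. f p \<partial>beta_prior c) = (\<integral>p. f p * beta_weight c p \<partial>lborel) / ?Z"
    unfolding beta_prior_def using nn
    by (subst integral_real_density) (auto simp: mult_ac)
qed

lemma prob_space_beta_prior: "prob_space (beta_prior c)"
proof -
  have "integrable (beta_prior c) (\<lambda>_. 1 :: real)" "(\<integral>p. 1 \<partial>beta_prior c) = (1::real)"
    using integral_beta_prior[of "\<lambda>_. 1" c] integral_beta_weight_pos[of c] by auto
  then have "enn2real (emeasure (beta_prior c) UNIV) = 1" by (simp add: measure_def)
  then have "emeasure (beta_prior c) UNIV = 1"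
    by (cases "emeasure (beta_prior c) UNIV") auto
  then show ?thesis by (intro prob_spaceI) simp
qed

lemma AE_beta_prior: "AE p in beta_prior c. \<bar>p\<bar> \<le> 1"
  unfolding beta_prior_def
  by (subst AE_density) (auto simp: beta_weight_def indicator_def split: if_splits)

text \<open>Times the weight, the integrand is the derivative of (1 - p^2)^(c + 1) * h p. The
  exponent c + 1 makes this vanish at both endpoints even for c = 0, so the fundamental theorem of
  calculus gives 0.\<close>

lemma beta_prior_stein:
  assumes h: "\<And>x. (h has_real_derivative h' x) (at x)" and h': "continuous_on UNIV h'"
  shows "(\<integral>p. (1 - p\<^sup>2) * h' p - 2 * (real c + 1) * p * h p \<partial>beta_prior c) = 0"
proof -
  have ch: "continuous_on UNIV h" using h by (auto intro!: continuous_at_imp_continuous_on DERIV_isCont)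
  let ?g = "\<lambda>p. (1 - p\<^sup>2) * h' p - 2 * (real c + 1) * p * h p"
  have cg: "continuous_on UNIV ?g" by (intro continuous_intros ch h')
  have "(\<integral>p. ?g p * beta_weight c p \<partial>lborel) = (\<integral>p. (?g p * (1 - p\<^sup>2) ^ c) * indicator {-1..1} p \<partial>lborel)"
    by (simp add: beta_weight_def mult_ac)
  also have "\<dots> = (1 - 1\<^sup>2) ^ Suc c * h 1 - (1 - (-1)\<^sup>2) ^ Suc c * h (-1)"
  proof (rule integral_FTC_Icc_real)
    show "((\<lambda>p. (1 - p\<^sup>2) ^ Suc c * h p) has_real_derivative ?g x * (1 - x\<^sup>2) ^ c) (at x)" for x
      by (rule derivative_eq_intros h | simp)+ (simp add: algebra_simps power2_eq_square)
    show "isCont (\<lambda>p. ?g p * (1 - p\<^sup>2) ^ c) x" for x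
      using ch h' by (auto intro!: continuous_intros simp: continuous_on_eq_continuous_at)
  qed simp
  finally show ?thesis using integral_beta_prior(2)[OF cg, of c] by simp
qed

text \<open>Stein's identity for h p = p and h p = p^3 yields linear equations for the moments, so
  the normalising integral is never evaluated.\<close>

lemma beta_prior_moments:
  "(\<integral>p. p\<^sup>2 \<partial>beta_prior c) = 1 / (2 * real c + 3)"
  "(\<integral>p. p ^ 4 \<partial>beta_prior c) = 3 / ((2 * real c + 3) * (2 * real c + 5))"
proof -
  interpret prob_space "beta_prior c" by (rule prob_space_beta_prior)
  have i: "integrable (beta_prior c) (\<lambda>p. p ^ k)" for k
    by (intro integral_beta_prior continuous_intros)
  have "0 = (\<integral>p. 1 - (2 * real c + 3) * p\<^sup>2 \<partial>beta_prior c)"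
    using beta_prior_stein[of "\<lambda>p. p" "\<lambda>_. 1" c]
    by (simp add: algebra_simps power2_eq_square)
  also have "\<dots> = 1 - (2 * real c + 3) * (\<integral>p. p\<^sup>2 \<partial>beta_prior c)"
    using i by (simp add: prob_space[simplified])
  finally show 2: "(\<integral>p. p\<^sup>2 \<partial>beta_prior c) = 1 / (2 * real c + 3)" by (simp add: field_simps)
  have "0 = (\<integral>p. 3 * p\<^sup>2 - (2 * real c + 5) * p ^ 4 \<partial>beta_prior c)"
  proof -
    have "((\<lambda>p. p ^ 3) has_real_derivative 3 * x\<^sup>2) (at x)" for x :: real
      by (rule derivative_eq_intros refl)+ simp
    from beta_prior_stein[OF this, of c] show ?thesis
      by (simp add: continuous_intros algebra_simps power2_eq_square power4_eq_xxxx power3_eq_cube)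
  qed
  also have "\<dots> = 3 * (\<integral>p. p\<^sup>2 \<partial>beta_prior c) - (2 * real c + 5) * (\<integral>p. p ^ 4 \<partial>beta_prior c)"
    using i by simp
  finally show "(\<integral>p. p ^ 4 \<partial>beta_prior c) = 3 / ((2 * real c + 3) * (2 * real c + 5))"
    unfolding 2
    by (simp add: eq_divide_eq) (simp add: divide_eq_eq eq_divide_eq mult_ac)
qed

section \<open>The product prior on the cube\<close>

definition prior :: "nat \<Rightarrow> nat \<Rightarrow> (nat \<Rightarrow> real) measure" where
  "prior d c = (\<Pi>\<^sub>M j\<in>{..<d}. beta_prior c)"

lemma prob_space_prior: "prob_space (prior d c)"
  unfolding prior_def by (intro prob_space_PiM prob_space_beta_prior)

lemma sets_prior [measurable_cong]: "sets (prior d c) = sets (euclid d)"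
  unfolding prior_def euclid_def by (intro sets_PiM_cong) auto

text \<open>The prior is a measure on all of R^d, whereas sign weights are probabilities only on the
  cube. Bounds proved on the cube pass to prior integrals through this statement.\<close>

lemma AE_prior: "AE m in prior d c. \<forall>j<d. \<bar>m j\<bar> \<le> 1"
proof -
  have "AE m in prior d c. \<bar>m j\<bar> \<le> 1" if "j < d" for j
    unfolding prior_def using that
    by (intro AE_PiM_component[of "{..<d}" "\<lambda>_. beta_prior c" j "\<lambda>x. \<bar>x\<bar> \<le> 1"] prob_space_beta_prior AE_beta_prior) auto
  then have "AE m in prior d c. \<forall>j\<in>{..<d}. \<bar>m j\<bar> \<le> 1"
    by (intro eventually_ball_finite) auto
  then show ?thesis by (simp add: Ball_def)
qed

lemma integrable_prior_bounded:
  fixes f :: "(nat \<Rightarrow> real) \<Rightarrow> real"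
  assumes "f \<in> borel_measurable (euclid d)" "\<And>m. (\<And>j. j < d \<Longrightarrow> \<bar>m j\<bar> \<le> 1) \<Longrightarrow> \<bar>f m\<bar> \<le> B"
  shows "integrable (prior d c) f"
proof -
  interpret prob_space "prior d c" by (rule prob_space_prior)
  show ?thesis
    using AE_prior[of d c] assms by (intro integrable_const_bound[where B=B]) (auto simp: measurable_cong_sets[OF sets_prior refl])
qed

lemma integral_prior_component:
  assumes "j < d" and [measurable]: "g \<in> borel_measurable borel"
  shows "(\<integral>m. g (m j) \<partial>prior d c) = (\<integral>p. (g p :: real) \<partial>beta_prior c)"
proof -
  have "(\<integral>p. g p \<partial>beta_prior c) = (\<integral>p. g p \<partial>distr (prior d c) (beta_prior c) (\<lambda>m. m j))"
    unfolding prior_def using assms by (subst distr_PiM_component) (auto intro: prob_space_beta_prior)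
  also have "\<dots> = (\<integral>m. g (m j) \<partial>prior d c)"
    using assms unfolding prior_def
    by (intro integral_distr) (auto simp: measurable_cong_sets[OF sets_beta_prior refl])
  finally show ?thesis ..
qed

lemma integral_prior_prod:
  fixes g :: "nat \<Rightarrow> real \<Rightarrow> real"
  assumes "\<And>j. j < d \<Longrightarrow> continuous_on UNIV (g j)"
  shows "(\<integral>m. (\<Prod>j<d. g j (m j)) \<partial>prior d c) = (\<Prod>j<d. \<integral>p. g j p \<partial>beta_prior c)"
proof -
  interpret product_prob_space "\<lambda>_::nat. beta_prior c"
    by (intro product_prob_spaceI prob_space_beta_prior)
  show ?thesis unfolding prior_def using assms
    by (intro product_integral_prod integral_beta_prior) auto
qed

text \<open>A minorant of \<open>\<bar>p\<bar>\<close> whose prior mean is explicit, unlike that of \<open>\<bar>p\<bar>\<close> itself.\<close>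

lemma abs_ge_quartic:
  assumes "0 < (\<sigma>::real)"
  shows "p\<^sup>2 / \<sigma> - p ^ 4 / (4 * \<sigma> ^ 3) \<le> \<bar>p\<bar>"
proof -
  define t where "t = \<bar>p\<bar> / \<sigma>"
  have t: "0 \<le> t" "\<bar>p\<bar> = t * \<sigma>" using assms by (auto simp: t_def)
  \<comment> \<open>After scaling by \<sigma>, the claim is t * (1 - t + t^3 / 4) \<ge> 0 for t
    \<ge> 0. The cubic has its minimum at 2 / sqrt 3, close to 6/5; its part with double root 6/5
    leaves a remainder with nonnegative coefficients.\<close>
  have "0 \<le> (t - 6/5)\<^sup>2 * (t + 12/5) / 4 + (2 / 25 * t + 17 / 125)" using t by simp
  also have "\<dots> = 1 - t + t ^ 3 / 4"
    by (simp add: power2_eq_square power3_eq_cube field_simps)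
  finally have "0 \<le> t * (1 - t + t ^ 3 / 4)" using t by simp
  then have "t\<^sup>2 - t ^ 4 / 4 \<le> t" by (simp add: power2_eq_square power3_eq_cube power4_eq_xxxx algebra_simps)
  then have "(t\<^sup>2 - t ^ 4 / 4) * \<sigma> \<le> t * \<sigma>" using assms by (intro mult_right_mono) auto
  moreover have "p\<^sup>2 = (t * \<sigma>)\<^sup>2" "p ^ 4 = (t * \<sigma>) ^ 4"
    using t(2) by (metis power2_abs, metis power_even_abs even_numeral)
  then have "p\<^sup>2 / \<sigma> = t\<^sup>2 * \<sigma>" "p ^ 4 / (4 * \<sigma> ^ 3) = t ^ 4 / 4 * \<sigma>"
    using assms by (simp_all only: power_mult_distrib, simp_all add: power2_eq_square power3_eq_cube power4_eq_xxxx)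
  ultimately show ?thesis using t(2) by (simp add: left_diff_distrib)
qed

text \<open>Here \<sigma> is the standard deviation of the prior. The fourth moment is at most the
  Gaussian value 3 * \<sigma>^4, so the mean of the minorant is at least \<sigma> - 3 \<sigma> /
  4.\<close>

lemma beta_prior_abs_lower:
  fixes c :: nat
  defines "\<sigma> \<equiv> 1 / sqrt (2 * real c + 3)"
  shows "\<sigma> / 4 \<le> (\<integral>p. p\<^sup>2 / \<sigma> - p ^ 4 / (4 * \<sigma> ^ 3) \<partial>beta_prior c)"
proof -
  have \<sigma>: "0 < \<sigma>" unfolding \<sigma>_def by simp
  have sq: "\<sigma>\<^sup>2 = 1 / (2 * real c + 3)" unfolding \<sigma>_def by (simp add: power_divide)
  have i: "integrable (beta_prior c) (\<lambda>p. p ^ k)" for k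
    by (intro integral_beta_prior continuous_intros)
  have "(\<integral>p. p ^ 4 \<partial>beta_prior c) = 3 * \<sigma>\<^sup>2 * (1 / (2 * real c + 5))"
    unfolding beta_prior_moments sq by simp
  also have "\<dots> \<le> 3 * \<sigma>\<^sup>2 * \<sigma>\<^sup>2"
    unfolding sq by (intro mult_left_mono) (auto simp: field_simps)
  finally have 4: "(\<integral>p. p ^ 4 \<partial>beta_prior c) \<le> 3 * \<sigma> ^ 4" by (simp add: power2_eq_square power4_eq_xxxx)
  have "\<sigma> / 4 = \<sigma>\<^sup>2 / \<sigma> - 3 * \<sigma> ^ 4 / (4 * \<sigma> ^ 3)"
    using \<sigma> by (simp add: power2_eq_square power3_eq_cube power4_eq_xxxx field_simps)
  also have "\<dots> \<le> (\<integral>p. p\<^sup>2 \<partial>beta_prior c) / \<sigma> - (\<integral>p. p ^ 4 \<partial>beta_prior c) / (4 * \<sigma> ^ 3)"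
    using 4 \<sigma> by (intro diff_mono divide_right_mono) (auto simp: beta_prior_moments sq)
  also have "\<dots> = (\<integral>p. p\<^sup>2 / \<sigma> - p ^ 4 / (4 * \<sigma> ^ 3) \<partial>beta_prior c)"
    using i by (subst Bochner_Integration.integral_diff) auto
  finally show ?thesis .
qed

subsection \<open>The sparse sign distributions\<close>

text \<open>A label \<open>None\<close> stands for the data point \<open>0\<close> and has probability \<open>1 - q\<close>; a label \<open>Some z\<close>
  stands for the data point \<open>R z\<close>, where \<open>z\<close> has independent signs with mean \<open>m\<close>. The vector
  \<open>score m l\<close> is the gradient of the log-likelihood in \<open>m\<close> with coordinate \<open>j\<close> multiplied by
  \<open>1 - (m j)\<^sup>2\<close>.\<close>

definition signs :: "nat \<Rightarrow> (nat \<Rightarrow> real) set" where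
  "signs d = PiE {..<d} (\<lambda>_. {-1, 1})"

definition sign_weight :: "nat \<Rightarrow> (nat \<Rightarrow> real) \<Rightarrow> (nat \<Rightarrow> real) \<Rightarrow> real" where
  "sign_weight d m z = (\<Prod>j<d. (1 + m j * z j) / 2)"

definition labels :: "nat \<Rightarrow> (nat \<Rightarrow> real) option set" where
  "labels d = insert None (Some ` signs d)"

definition weight :: "nat \<Rightarrow> real \<Rightarrow> (nat \<Rightarrow> real) \<Rightarrow> (nat \<Rightarrow> real) option \<Rightarrow> real" where
  "weight d q m l = (case l of None \<Rightarrow> 1 - q | Some z \<Rightarrow> q * sign_weight d m z)"

definition point :: "nat \<Rightarrow> real \<Rightarrow> (nat \<Rightarrow> real) option \<Rightarrow> nat \<Rightarrow> real" where
  "point d R l = (\<lambda>j\<in>{..<d}. case l of None \<Rightarrow> 0 | Some z \<Rightarrow> R * z j)"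

definition score :: "(nat \<Rightarrow> real) \<Rightarrow> (nat \<Rightarrow> real) option \<Rightarrow> nat \<Rightarrow> real" where
  "score m l j = (case l of None \<Rightarrow> 0 | Some z \<Rightarrow> z j - m j)"

definition sparse_law :: "nat \<Rightarrow> real \<Rightarrow> real \<Rightarrow> (nat \<Rightarrow> real) \<Rightarrow> (nat \<Rightarrow> real) measure" where
  "sparse_law d q R m =
     distr (point_measure (labels d) (\<lambda>l. ennreal (weight d q m l))) (euclid d) (point d R)"

lemma finite_signs: "finite (signs d)"
  unfolding signs_def by (intro finite_PiE) auto

lemma finite_labels: "finite (labels d)"
  unfolding labels_def by (simp add: finite_signs)

lemma sum_labels: "(\<Sum>l\<in>labels d. h l) = h None + (\<Sum>z\<in>signs d. h (Some z))"
  unfolding labels_def by (subst sum.insert) (auto simp: finite_signs sum.reindex)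

text \<open>Independence of the signs: the expectation of a product of one-coordinate functions
  factorises. Means, covariances and the exponential moment below are all instances.\<close>

lemma sum_sign_weight_prod:
  "(\<Sum>z\<in>signs d. sign_weight d m z * (\<Prod>j<d. g j (z j)))
    = (\<Prod>j<d. (1 - m j) / 2 * g j (-1) + (1 + m j) / 2 * g j 1)"
proof -
  have "(\<Sum>z\<in>signs d. sign_weight d m z * (\<Prod>j<d. g j (z j)))
    = (\<Sum>z\<in>PiE {..<d} (\<lambda>_. {-1, 1}). \<Prod>j<d. (1 + m j * z j) / 2 * g j (z j))"
    unfolding signs_def sign_weight_def by (simp flip: prod.distrib)
  also have "\<dots> = (\<Prod>j<d. \<Sum>x\<in>{-1, 1}. (1 + m j * x) / 2 * g j x)"
    by (intro prod_sum_PiE[symmetric]) auto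
  finally show ?thesis by simp
qed

lemma sum_sign_weight: "sum (sign_weight d m) (signs d) = 1"
  using sum_sign_weight_prod[of d m "\<lambda>_ _. 1"] by (simp add: field_simps)

lemma sign_weight_nonneg:
  assumes "\<And>j. j < d \<Longrightarrow> \<bar>m j\<bar> \<le> 1" "z \<in> signs d"
  shows "0 \<le> sign_weight d m z"
  unfolding sign_weight_def
proof (intro prod_nonneg ballI)
  fix j assume "j \<in> {..<d}"
  then have "\<bar>m j\<bar> \<le> 1" "z j = -1 \<or> z j = 1" using assms by (auto simp: signs_def PiE_iff)
  then show "0 \<le> (1 + m j * z j) / 2" by (auto simp: abs_le_iff)
qed

lemma sum_sign_weight_component:
  assumes "j < d"
  shows "(\<Sum>z\<in>signs d. sign_weight d m z * z j) = m j"
proof -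
  have "(\<Sum>z\<in>signs d. sign_weight d m z * z j)
     = (\<Sum>z\<in>signs d. sign_weight d m z * (\<Prod>k<d. if k = j then z k else 1))"
    using assms by (simp add: prod.delta)
  also have "\<dots> = (\<Prod>k<d. (1 - m k) / 2 * (if k = j then -1 else 1) + (1 + m k) / 2 * (if k = j then 1 else 1))"
    by (rule sum_sign_weight_prod)
  also have "\<dots> = (\<Prod>k<d. if k = j then m k else 1)"
    by (intro prod.cong refl) (auto simp: field_simps)
  finally show ?thesis using assms by (simp add: prod.delta)
qed

lemma sum_sign_weight_covariance:
  assumes "i < d" "j < d"
  shows "(\<Sum>z\<in>signs d. sign_weight d m z * ((z i - m i) * (z j - m j))) = (if i = j then 1 - (m j)\<^sup>2 else 0)"
proof -
  let ?g = "\<lambda>k x. (if k = i then x - m i else 1) * (if k = j then x - m j else 1)"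
  have "(\<Sum>z\<in>signs d. sign_weight d m z * ((z i - m i) * (z j - m j)))
     = (\<Sum>z\<in>signs d. sign_weight d m z * (\<Prod>k<d. ?g k (z k)))"
    using assms by (simp add: prod.distrib prod.delta)
  also have "\<dots> = (\<Prod>k<d. (1 - m k) / 2 * ?g k (-1) + (1 + m k) / 2 * ?g k 1)"
    by (rule sum_sign_weight_prod)
  also have "\<dots> = (if i = j then 1 - (m j)\<^sup>2 else 0)"
  proof (cases "i = j")
    case True
    have "(\<Prod>k<d. (1 - m k) / 2 * ?g k (-1) + (1 + m k) / 2 * ?g k 1) = (\<Prod>k<d. if k = j then 1 - (m k)\<^sup>2 else 1)"
      using True by (intro prod.cong refl) (simp add: power2_eq_square field_simps)
    then show ?thesis using True assms by (simp add: prod.delta)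
  next
    case False
    have "(1 - m i) / 2 * ?g i (-1) + (1 + m i) / 2 * ?g i 1 = 0"
      using False by (simp add: field_simps)
    then have "(\<Prod>k<d. (1 - m k) / 2 * ?g k (-1) + (1 + m k) / 2 * ?g k 1) = 0"
      using assms(1) by (intro prod_zero bexI[of _ i]) (simp_all only: finite_lessThan lessThan_iff)
    then show ?thesis using False by simp
  qed
  finally show ?thesis .
qed

lemma sum_weight: "sum (weight d q m) (labels d) = 1"
  using sum_sign_weight[of d m] by (simp add: sum_labels weight_def flip: sum_distrib_left)

lemma weight_nonneg:
  assumes "\<And>j. j < d \<Longrightarrow> \<bar>m j\<bar> \<le> 1" "0 \<le> q" "q \<le> 1" "l \<in> labels d"
  shows "0 \<le> weight d q m l"
  using assms sign_weight_nonneg[of d m] by (auto simp: weight_def labels_def)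

lemma sum_weight_score:
  assumes "j < d"
  shows "(\<Sum>l\<in>labels d. weight d q m l * score m l j) = 0"
proof -
  have "(\<Sum>z\<in>signs d. sign_weight d m z * (z j - m j)) = 0"
    using sum_sign_weight_component[OF assms, of m] sum_sign_weight[of d m]
    by (simp add: right_diff_distrib sum_subtractf flip: sum_distrib_right)
  then show ?thesis by (simp add: sum_labels weight_def score_def mult.assoc flip: sum_distrib_left)
qed

text \<open>Expanding the square gives a double sum over coordinates in which the covariance is
  diagonal.\<close>

lemma sum_weight_inner_score_square:
  "(\<Sum>z\<in>signs d. sign_weight d m z * (euclid_inner d a (score m (Some z)))\<^sup>2) = (\<Sum>j<d. (a j)\<^sup>2 * (1 - (m j)\<^sup>2))"
proof -
  have "(\<Sum>z\<in>signs d. sign_weight d m z * (euclid_inner d a (score m (Some z)))\<^sup>2)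
      = (\<Sum>z\<in>signs d. \<Sum>i<d. \<Sum>j<d. (a i * a j) * (sign_weight d m z * ((z i - m i) * (z j - m j))))"
  proof (intro sum.cong refl)
    fix z
    have "(euclid_inner d a (score m (Some z)))\<^sup>2
        = (\<Sum>i<d. \<Sum>j<d. (a i * (z i - m i)) * (a j * (z j - m j)))"
      unfolding euclid_inner_def power2_eq_square score_def option.case by (rule sum_product)
    then have "sign_weight d m z * (euclid_inner d a (score m (Some z)))\<^sup>2
        = (\<Sum>i<d. \<Sum>j<d. sign_weight d m z * ((a i * (z i - m i)) * (a j * (z j - m j))))"
      by (simp only: sum_distrib_left)
    also have "\<dots> = (\<Sum>i<d. \<Sum>j<d. (a i * a j) * (sign_weight d m z * ((z i - m i) * (z j - m j))))"
      by (intro sum.cong refl) (simp only: mult_ac)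
    finally show "sign_weight d m z * (euclid_inner d a (score m (Some z)))\<^sup>2
        = (\<Sum>i<d. \<Sum>j<d. (a i * a j) * (sign_weight d m z * ((z i - m i) * (z j - m j))))" .
  qed
  also have "\<dots> = (\<Sum>i<d. \<Sum>z\<in>signs d. \<Sum>j<d. (a i * a j) * (sign_weight d m z * ((z i - m i) * (z j - m j))))"
    by (rule sum.swap)
  also have "\<dots> = (\<Sum>i<d. \<Sum>j<d. \<Sum>z\<in>signs d. (a i * a j) * (sign_weight d m z * ((z i - m i) * (z j - m j))))"
    by (intro sum.cong refl sum.swap)
  also have "\<dots> = (\<Sum>i<d. \<Sum>j<d. (a i * a j) * (if i = j then 1 - (m j)\<^sup>2 else 0))"
    by (simp add: sum_sign_weight_covariance flip: sum_distrib_left)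
  also have "\<dots> = (\<Sum>i<d. \<Sum>j<d. if i = j then (a i * a j) * (1 - (m j)\<^sup>2) else 0)"
    by (intro sum.cong refl) auto
  also have "\<dots> = (\<Sum>j<d. (a j)\<^sup>2 * (1 - (m j)\<^sup>2))"
    by (simp add: power2_eq_square)
  finally show ?thesis .
qed

lemma score_None: "score m None = (\<lambda>_. 0)"
  by (simp add: score_def fun_eq_iff)

text \<open>A single score correlates with a fixed vector at the order of its standard deviation,
  without the factor sqrt d that the norm of the score would cost. The factor q appears because the
  score of \<open>None\<close> is 0.\<close>

lemma sum_weight_abs_inner_score:
  assumes m: "\<And>j. j < d \<Longrightarrow> \<bar>m j\<bar> \<le> 1" and q: "0 \<le> q"
  shows "(\<Sum>l\<in>labels d. weight d q m l * \<bar>euclid_inner d a (score m l)\<bar>) \<le> q * euclid_norm d a"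
proof -
  have "(\<Sum>z\<in>signs d. sign_weight d m z * \<bar>euclid_inner d a (score m (Some z))\<bar>)
     \<le> sqrt (\<Sum>z\<in>signs d. sign_weight d m z * \<bar>euclid_inner d a (score m (Some z))\<bar>\<^sup>2)"
    by (intro weighted_sum_le_sqrt sum_sign_weight sign_weight_nonneg m)
  also have "\<dots> = sqrt (\<Sum>j<d. (a j)\<^sup>2 * (1 - (m j)\<^sup>2))"
    by (simp add: sum_weight_inner_score_square)
  also have "\<dots> \<le> sqrt (\<Sum>j<d. (a j)\<^sup>2)"
    by (intro real_sqrt_le_mono sum_mono mult_left_le) auto
  finally have *: "(\<Sum>z\<in>signs d. sign_weight d m z * \<bar>euclid_inner d a (score m (Some z))\<bar>) \<le> euclid_norm d a"
    by (simp add: euclid_norm_def L2_set_def)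
  have "(\<Sum>l\<in>labels d. weight d q m l * \<bar>euclid_inner d a (score m l)\<bar>)
     = q * (\<Sum>z\<in>signs d. sign_weight d m z * \<bar>euclid_inner d a (score m (Some z))\<bar>)"
    by (simp add: sum_labels weight_def score_None euclid_inner_def sum_distrib_left mult_ac)
  then show ?thesis using mult_left_mono[OF * q] by simp
qed

lemma sum_weight_score_square:
  assumes "j < d"
  shows "(\<Sum>l\<in>labels d. weight d q m l * (score m l j)\<^sup>2) = q * (1 - (m j)\<^sup>2)"
  using sum_sign_weight_covariance[OF assms assms, of m]
  by (simp add: sum_labels weight_def score_def power2_eq_square mult.assoc flip: sum_distrib_left)

text \<open>The sqrt d lost here is affordable because the bound is only ever multiplied by
  \<delta>.\<close>

lemma sum_weight_norm_score:
  assumes m: "\<And>j. j < d \<Longrightarrow> \<bar>m j\<bar> \<le> 1" and q: "0 \<le> q"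
  shows "(\<Sum>l\<in>labels d. weight d q m l * euclid_norm d (score m l)) \<le> q * sqrt d"
proof -
  have "(\<Sum>z\<in>signs d. sign_weight d m z * euclid_norm d (score m (Some z)))
     \<le> sqrt (\<Sum>z\<in>signs d. sign_weight d m z * (euclid_norm d (score m (Some z)))\<^sup>2)"
    by (intro weighted_sum_le_sqrt sum_sign_weight sign_weight_nonneg m)
  also have "(\<Sum>z\<in>signs d. sign_weight d m z * (euclid_norm d (score m (Some z)))\<^sup>2)
     = (\<Sum>z\<in>signs d. \<Sum>j<d. sign_weight d m z * ((z j - m j) * (z j - m j)))"
    unfolding euclid_norm_square sum_distrib_left score_def by (simp add: power2_eq_square)
  also have "\<dots> = (\<Sum>j<d. \<Sum>z\<in>signs d. sign_weight d m z * ((z j - m j) * (z j - m j)))"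
    by (rule sum.swap)
  also have "\<dots> = (\<Sum>j<d. 1 - (m j)\<^sup>2)" by (simp add: sum_sign_weight_covariance)
  also have "sqrt \<dots> \<le> sqrt (\<Sum>j<d. 1)"
    by (intro real_sqrt_le_mono sum_mono) auto
  finally have *: "(\<Sum>z\<in>signs d. sign_weight d m z * euclid_norm d (score m (Some z))) \<le> sqrt d" by simp
  have "(\<Sum>l\<in>labels d. weight d q m l * euclid_norm d (score m l))
     = q * (\<Sum>z\<in>signs d. sign_weight d m z * euclid_norm d (score m (Some z)))"
    by (simp add: sum_labels weight_def score_None euclid_norm_def L2_set_def sum_distrib_left mult_ac)
  then show ?thesis using mult_left_mono[OF * q] by simp
qed

lemma point_in_space [simp]: "point d R l \<in> space (euclid d)"
  by (simp add: point_def euclid_def space_PiM)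

lemma point_measurable [measurable]: "point d R \<in> point_measure (labels d) w \<rightarrow>\<^sub>M euclid d"
  using point_in_space by auto

lemma prob_space_sparse_law:
  assumes "\<And>j. j < d \<Longrightarrow> \<bar>m j\<bar> \<le> 1" "0 \<le> q" "q \<le> 1"
  shows "prob_space (sparse_law d q R m)"
proof -
  have "(\<Sum>l\<in>labels d. ennreal (weight d q m l)) = 1"
    using sum_weight[of d q m] weight_nonneg[OF assms] by (simp add: sum_ennreal)
  then have "prob_space (point_measure (labels d) (\<lambda>l. ennreal (weight d q m l)))"
    by (intro prob_space_point_measure finite_labels) auto
  then show ?thesis unfolding sparse_law_def by (rule prob_space.prob_space_distr) measurable
qed

lemma sets_sparse_law [simp]: "sets (sparse_law d q R m) = sets (euclid d)"
  by (simp add: sparse_law_def)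

lemma has_mean_sparse_law:
  assumes m: "\<And>j. j < d \<Longrightarrow> \<bar>m j\<bar> \<le> 1" and q: "0 \<le> q" "q \<le> 1"
  shows "has_mean d (sparse_law d q R m) (\<lambda>j\<in>{..<d}. q * R * m j)"
  unfolding has_mean_def
proof (intro conjI allI impI)
  show "(\<lambda>j\<in>{..<d}. q * R * m j) \<in> space (euclid d)" by (simp add: euclid_def space_PiM)
  fix j assume j: "j < d"
  let ?P = "point_measure (labels d) (\<lambda>l. ennreal (weight d q m l))"
  have int: "integrable ?P (\<lambda>l. point d R l j)"
    using weight_nonneg[OF m q] by (intro integrable_point_measure_finite) (auto simp: finite_labels)
  then show "integrable (sparse_law d q R m) (\<lambda>y. y j)"
    unfolding sparse_law_def using j by (subst integrable_distr_eq) auto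
  have "(\<integral>y. y j \<partial>sparse_law d q R m) = (\<integral>l. point d R l j \<partial>?P)"
    unfolding sparse_law_def using j by (subst integral_distr) auto
  also have "\<dots> = (\<Sum>l\<in>labels d. weight d q m l * point d R l j)"
    using weight_nonneg[OF m q] by (subst lebesgue_integral_point_measure_finite) (auto simp: finite_labels)
  also have "\<dots> = q * R * (\<Sum>z\<in>signs d. sign_weight d m z * z j)"
    using j by (simp add: sum_labels weight_def point_def sum_distrib_left mult_ac)
  finally show "(\<integral>y. y j \<partial>sparse_law d q R m) = (\<lambda>j\<in>{..<d}. q * R * m j) j"
    using j by (simp add: sum_sign_weight_component)
qed

section \<open>Dimension-free moment bounds\<close>

lemma exp_le_quadratic:
  assumes "\<bar>x::real\<bar> \<le> 1"
  shows "exp x \<le> 1 + x + x\<^sup>2"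
proof (cases "0 \<le> x")
  case True
  then show ?thesis using exp_bound[of x] assms by simp
next
  case False
  have "0 \<le> (x + 1 / 2)\<^sup>2 + 3 / 4" by simp
  then have "0 \<le> 1 + x + x\<^sup>2" by (simp add: power2_eq_square algebra_simps)
  \<comment> \<open>For negative x the quadratic is compared with the reciprocal of exp (- x): its
    product with the Taylor minorant of exp (- x) is 1 plus a nonnegative term.\<close>
  then have "(1 + x + x\<^sup>2) * (1 + (- x) + x\<^sup>2 / 2) \<le> (1 + x + x\<^sup>2) * exp (- x)"
    using exp_lower_Taylor_quadratic[of "- x"] False by (intro mult_left_mono) auto
  moreover have "(1 + x + x\<^sup>2) * (1 + (- x) + x\<^sup>2 / 2) = 1 + x\<^sup>2 / 2 * (1 - x + x\<^sup>2)"
    by (simp add: field_simps power2_eq_square)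
  moreover have "0 \<le> x\<^sup>2 / 2 * (1 - x + x\<^sup>2)"
    using False by (intro mult_nonneg_nonneg add_nonneg_nonneg) auto
  ultimately have "1 \<le> (1 + x + x\<^sup>2) * exp (- x)" by linarith
  then show ?thesis by (simp add: exp_minus field_simps)
qed

text \<open>A sub-Gaussian estimate: each factor of the moment generating function is at most exp (m
  j * v j + (v j)^2), and the exponents add up to an inner product plus the squared norm of v, which
  is 1. The dimension drops out.\<close>

lemma sum_sign_weight_exp:
  assumes m: "\<And>j. j < d \<Longrightarrow> \<bar>m j\<bar> \<le> 1" and v: "euclid_norm d v = 1"
  shows "(\<Sum>z\<in>signs d. sign_weight d m z * exp (euclid_inner d z v)) \<le> exp (euclid_norm d m + 1)"
proof -
  have v1: "\<bar>v j\<bar> \<le> 1" if "j < d" for j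
  proof -
    have "(v j)\<^sup>2 \<le> (\<Sum>i<d. (v i)\<^sup>2)" using that by (intro member_le_sum) auto
    then have "(v j)\<^sup>2 \<le> 1" using euclid_norm_square[of d v] v by simp
    then show ?thesis by (simp add: abs_square_le_1)
  qed
  have "(\<Sum>z\<in>signs d. sign_weight d m z * exp (euclid_inner d z v))
     = (\<Sum>z\<in>signs d. sign_weight d m z * (\<Prod>j<d. exp (z j * v j)))"
    by (simp add: euclid_inner_def exp_sum)
  also have "\<dots> = (\<Prod>j<d. (1 - m j) / 2 * exp ((-1) * v j) + (1 + m j) / 2 * exp (1 * v j))"
    by (rule sum_sign_weight_prod)
  also have "\<dots> \<le> (\<Prod>j<d. exp (m j * v j + (v j)\<^sup>2))"
  proof (rule prod_mono, intro conjI)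
    fix j assume "j \<in> {..<d}"
    then have mj: "0 \<le> 1 - m j" "0 \<le> 1 + m j" and vj: "\<bar>v j\<bar> \<le> 1" using m[of j] v1[of j] by auto
    show "0 \<le> (1 - m j) / 2 * exp ((-1) * v j) + (1 + m j) / 2 * exp (1 * v j)" using mj by simp
    have "(1 - m j) / 2 * exp ((-1) * v j) + (1 + m j) / 2 * exp (1 * v j)
       \<le> (1 - m j) / 2 * (1 + (- v j) + (- v j)\<^sup>2) + (1 + m j) / 2 * (1 + v j + (v j)\<^sup>2)"
      using mj vj exp_le_quadratic[of "- v j"] exp_le_quadratic[of "v j"]
      by (intro add_mono mult_left_mono) auto
    also have "\<dots> = 1 + (m j * v j + (v j)\<^sup>2)" by (simp add: field_simps power2_eq_square)
    also have "\<dots> \<le> exp (m j * v j + (v j)\<^sup>2)" by (rule exp_ge_add_one_self)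
    finally show "(1 - m j) / 2 * exp ((-1) * v j) + (1 + m j) / 2 * exp (1 * v j) \<le> exp (m j * v j + (v j)\<^sup>2)" .
  qed
  also have "\<dots> = exp (euclid_inner d m v + (euclid_norm d v)\<^sup>2)"
    unfolding euclid_norm_square euclid_inner_def by (simp add: exp_sum sum.distrib[symmetric])
  also have "\<dots> \<le> exp (euclid_norm d m + 1)"
    using euclid_inner_le[of d m v] v by simp
  finally show ?thesis .
qed

lemma powr_le_exp:
  assumes "0 < k" "0 \<le> (x::real)"
  shows "x powr k \<le> k powr k * exp x"
proof -
  have "x / k \<le> exp (x / k)" using exp_ge_add_one_self[of "x / k"] by linarith
  then have "(x / k) powr k \<le> exp (x / k) powr k" using assms by (intro powr_mono2) auto
  also have "\<dots> = exp x" using assms by (simp add: powr_def)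
  finally show ?thesis using assms by (simp add: powr_divide divide_simps mult.commute)
qed

lemma powr_diff_le:
  assumes "0 < k"
  shows "\<bar>a - b::real\<bar> powr k \<le> 2 powr k * (\<bar>a\<bar> powr k + \<bar>b\<bar> powr k)"
proof -
  have "\<bar>a - b\<bar> powr k \<le> (2 * max \<bar>a\<bar> \<bar>b\<bar>) powr k"
    using assms by (intro powr_mono2) auto
  also have "\<dots> = 2 powr k * (max \<bar>a\<bar> \<bar>b\<bar>) powr k" by (simp add: powr_mult)
  also have "\<dots> \<le> 2 powr k * (\<bar>a\<bar> powr k + \<bar>b\<bar> powr k)"
    by (intro mult_left_mono) (auto simp: max_def)
  finally show ?thesis .
qed

text \<open>The power of |x| is dominated by k powr k * (exp x + exp (- x)), and the exponential
  bound applies to both v and its negative.\<close>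

lemma sum_sign_weight_powr:
  assumes m: "\<And>j. j < d \<Longrightarrow> \<bar>m j\<bar> \<le> 1" and v: "euclid_norm d v = 1" and k: "0 < k"
  shows "(\<Sum>z\<in>signs d. sign_weight d m z * \<bar>euclid_inner d z v\<bar> powr k)
    \<le> 2 * k powr k * exp (euclid_norm d m + 1)"
proof -
  let ?e = "\<lambda>u. \<Sum>z\<in>signs d. sign_weight d m z * exp (euclid_inner d z u)"
  have neg: "euclid_inner d z (\<lambda>j. - v j) = - euclid_inner d z v" for z
    by (simp add: euclid_inner_def sum_negf)
  have "\<bar>x\<bar> powr k \<le> k powr k * (exp x + exp (- x))" for x :: real
  proof -
    have "exp \<bar>x\<bar> \<le> exp x + exp (- x)" by (auto simp: abs_if)
    then have "k powr k * exp \<bar>x\<bar> \<le> k powr k * (exp x + exp (- x))" by (intro mult_left_mono) auto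
    then show ?thesis using powr_le_exp[OF k, of "\<bar>x\<bar>"] by simp
  qed
  then have "(\<Sum>z\<in>signs d. sign_weight d m z * \<bar>euclid_inner d z v\<bar> powr k)
    \<le> (\<Sum>z\<in>signs d. sign_weight d m z * (k powr k * (exp (euclid_inner d z v) + exp (- euclid_inner d z v))))"
    by (intro sum_mono mult_left_mono sign_weight_nonneg m)
  also have "\<dots> = k powr k * (?e v + ?e (\<lambda>j. - v j))"
    by (simp add: neg sum_distrib_left distrib_left sum.distrib mult_ac)
  also have "\<dots> \<le> k powr k * (exp (euclid_norm d m + 1) + exp (euclid_norm d m + 1))"
    using v euclid_norm_scale[of d "-1" v]
    by (intro mult_left_mono add_mono sum_sign_weight_exp m) auto
  finally show ?thesis by simp
qed

text \<open>The first summand bounds the moment about 0, where sparsity contributes q * R powr k;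
  the second pays for centring at a mean of norm at most A * T. The bound depends on m only through
  T, so the constant can be chosen independently of the dimension once large m are set
  aside.\<close>

lemma moment_bounded_sparse_law:
  assumes m: "\<And>j. j < d \<Longrightarrow> \<bar>m j\<bar> \<le> 1" and q: "0 \<le> q" "q \<le> 1" and R: "0 \<le> R" and k: "1 \<le> k"
    and qR: "q * R powr k \<le> A powr k" "q * R \<le> A" and mT: "euclid_norm d m \<le> T"
  shows "moment_bounded d k (2 powr k * (A powr k * (2 * k powr k * exp (T + 1)) + (A * T) powr k))
      (sparse_law d q R m) (\<lambda>j\<in>{..<d}. q * R * m j)"
  unfolding moment_bounded_def
proof (intro ballI impI)
  fix v assume v: "euclid_norm d v = 1"
  let ?\<mu> = "\<lambda>j\<in>{..<d}. q * R * m j"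
  let ?f = "\<lambda>y. \<bar>euclid_inner d (\<lambda>i. y i - ?\<mu> i) v\<bar> powr k"
  have T: "0 \<le> T" using mT euclid_norm_nonneg[of d m] by linarith
  have f: "?f \<in> borel_measurable (euclid d)" unfolding euclid_inner_def by measurable
  have "(\<integral>\<^sup>+y. ennreal (?f y) \<partial>sparse_law d q R m)
     = (\<integral>\<^sup>+l. ennreal (?f (point d R l)) \<partial>point_measure (labels d) (\<lambda>l. ennreal (weight d q m l)))"
    unfolding sparse_law_def using f by (intro nn_integral_distr point_measurable) simp
  also have "\<dots> = (\<Sum>l\<in>labels d. ennreal (weight d q m l) * ennreal (?f (point d R l)))"
    by (rule nn_integral_point_measure_finite[OF finite_labels])
  also have "\<dots> = ennreal (\<Sum>l\<in>labels d. weight d q m l * ?f (point d R l))"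
    using weight_nonneg[OF m q] by (subst sum_ennreal[symmetric]) (auto simp del: sum_ennreal simp: ennreal_mult intro!: sum.cong)
  also have "\<dots> \<le> ennreal (2 powr k * (A powr k * (2 * k powr k * exp (T + 1)) + (A * T) powr k))"
  proof (rule ennreal_leI)
    have fle: "?f (point d R l) \<le> 2 powr k * (\<bar>euclid_inner d (point d R l) v\<bar> powr k + (A * T) powr k)" for l
    proof -
      have eq: "euclid_inner d (\<lambda>i. point d R l i - ?\<mu> i) v
         = euclid_inner d (point d R l) v - q * R * euclid_inner d m v"
        unfolding euclid_inner_def sum_distrib_left sum_subtractf[symmetric]
        by (intro sum.cong) (auto simp: algebra_simps)
      have "\<bar>q * R * euclid_inner d m v\<bar> \<le> A * T"
      proof -
        have "\<bar>euclid_inner d m v\<bar> \<le> T" using euclid_inner_le[of d m v] v mT by simp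
        moreover have "0 \<le> q * R" using q R by simp
        ultimately have "(q * R) * \<bar>euclid_inner d m v\<bar> \<le> A * T"
          using qR(2) T by (intro mult_mono) auto
        then show ?thesis using \<open>0 \<le> q * R\<close> by (simp only: abs_mult[of "q * R"] abs_of_nonneg)
      qed
      then have "\<bar>q * R * euclid_inner d m v\<bar> powr k \<le> (A * T) powr k" using k by (intro powr_mono2) auto
      then have le: "2 powr k * (\<bar>euclid_inner d (point d R l) v\<bar> powr k + \<bar>q * R * euclid_inner d m v\<bar> powr k)
         \<le> 2 powr k * (\<bar>euclid_inner d (point d R l) v\<bar> powr k + (A * T) powr k)"
        by (intro mult_left_mono add_left_mono) auto
      have "\<bar>euclid_inner d (point d R l) v - q * R * euclid_inner d m v\<bar> powr k
         \<le> 2 powr k * (\<bar>euclid_inner d (point d R l) v\<bar> powr k + \<bar>q * R * euclid_inner d m v\<bar> powr k)"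
        using k by (intro powr_diff_le) simp
      then show ?thesis unfolding eq using le by (rule order_trans)
    qed
    have "(\<Sum>l\<in>labels d. weight d q m l * ?f (point d R l))
      \<le> (\<Sum>l\<in>labels d. weight d q m l * (2 powr k * (\<bar>euclid_inner d (point d R l) v\<bar> powr k + (A * T) powr k)))"
      by (intro sum_mono mult_left_mono fle weight_nonneg m q)
    also have "\<dots> = 2 powr k * ((\<Sum>l\<in>labels d. weight d q m l * \<bar>euclid_inner d (point d R l) v\<bar> powr k)
         + (\<Sum>l\<in>labels d. weight d q m l) * (A * T) powr k)"
      by (simp add: sum_distrib_left sum_distrib_right distrib_left sum.distrib mult_ac)
    also have "(\<Sum>l\<in>labels d. weight d q m l * \<bar>euclid_inner d (point d R l) v\<bar> powr k)
       = (q * R powr k) * (\<Sum>z\<in>signs d. sign_weight d m z * \<bar>euclid_inner d z v\<bar> powr k)"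
    proof -
      have "euclid_inner d (point d R None) v = 0" "euclid_inner d (point d R (Some z)) v = R * euclid_inner d z v" for z
        by (auto simp: euclid_inner_def point_def sum_distrib_left mult_ac)
      then show ?thesis using R k
        by (simp add: sum_labels weight_def abs_mult powr_mult sum_distrib_left mult_ac)
    qed
    also have "\<dots> \<le> A powr k * (2 * k powr k * exp (T + 1))"
    proof (rule mult_mono[OF qR(1)])
      have "(\<Sum>z\<in>signs d. sign_weight d m z * \<bar>euclid_inner d z v\<bar> powr k) \<le> 2 * k powr k * exp (euclid_norm d m + 1)"
        using k by (intro sum_sign_weight_powr m v) auto
      also have "\<dots> \<le> 2 * k powr k * exp (T + 1)" using mT by (intro mult_left_mono) auto
      finally show "(\<Sum>z\<in>signs d. sign_weight d m z * \<bar>euclid_inner d z v\<bar> powr k) \<le> 2 * k powr k * exp (T + 1)" .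
      show "0 \<le> (\<Sum>z\<in>signs d. sign_weight d m z * \<bar>euclid_inner d z v\<bar> powr k)"
        by (intro sum_nonneg mult_nonneg_nonneg sign_weight_nonneg m) auto
    qed auto
    finally show "(\<Sum>l\<in>labels d. weight d q m l * ?f (point d R l))
       \<le> 2 powr k * (A powr k * (2 * k powr k * exp (T + 1)) + (A * T) powr k)"
      by (simp add: sum_weight)
  qed
  finally show "(\<integral>\<^sup>+y. ennreal (?f y) \<partial>sparse_law d q R m)
     \<le> ennreal (2 powr k * (A powr k * (2 * k powr k * exp (T + 1)) + (A * T) powr k))" .
qed

subsection \<open>Stein's identity for the prior\<close>

text \<open>The weight of a label sequence is a constant times a product over coordinates, so the prior
  integral factorises and only the one-dimensional identity in coordinate \<open>j\<close> is needed.\<close>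

lemma prior_stein_weight:
  fixes n :: nat
  assumes X: "X \<in> PiE {..<n} (\<lambda>_. labels d)" and j: "j < d"
  shows "(\<integral>m. (\<Prod>i<n. weight d q m (X i)) * ((\<Sum>i<n. score m (X i) j) - 2 * (real c + 1) * m j) \<partial>prior d c) = 0"
proof -
  define C where "C = (\<Prod>i<n. case X i of None \<Rightarrow> 1 - q | Some _ \<Rightarrow> q)"
  define a where "a k i p = (case X i of None \<Rightarrow> 1 | Some z \<Rightarrow> (1 + p * z k) / 2)" for k i and p :: real
  define a' where "a' i = (case X i of None \<Rightarrow> 0 | Some z \<Rightarrow> z j / 2)" for i
  define u where "u k p = (\<Prod>i<n. a k i p)" for k p
  define s where "s i p = (case X i of None \<Rightarrow> 0 | Some z \<Rightarrow> z j - p)" for i and p :: real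
  \<comment> \<open>Only factor j carries the score and the prior term; its vanishing integral
    annihilates the whole product.\<close>
  define g where "g k p = (if k = j then u j p * ((\<Sum>i<n. s i p) - 2 * (real c + 1) * p) else u k p)" for k p
  have ca: "continuous_on UNIV (a k i)" for k i
    unfolding a_def by (cases "X i") (auto intro!: continuous_intros)
  have cu: "continuous_on UNIV (u k)" for k
    unfolding u_def by (intro continuous_intros ca)
  have cs: "continuous_on UNIV (s i)" for i
    unfolding s_def by (cases "X i") (auto intro!: continuous_intros)
  have cg: "continuous_on UNIV (g k)" for k
    unfolding g_def by (cases "k = j") (auto intro!: continuous_intros cu cs)
  have W: "(\<Prod>i<n. weight d q m (X i)) = C * (\<Prod>k<d. u k (m k))" for m
  proof -
    have "(\<Prod>i<n. weight d q m (X i))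
        = (\<Prod>i<n. (case X i of None \<Rightarrow> 1 - q | Some _ \<Rightarrow> q) * (\<Prod>k<d. a k i (m k)))"
      by (intro prod.cong refl) (auto simp: weight_def sign_weight_def a_def split: option.split)
    also have "\<dots> = C * (\<Prod>i<n. \<Prod>k<d. a k i (m k))" by (simp add: prod.distrib C_def)
    also have "(\<Prod>i<n. \<Prod>k<d. a k i (m k)) = (\<Prod>k<d. u k (m k))"
      unfolding u_def by (rule prod.swap)
    finally show ?thesis .
  qed
  have split: "(\<Prod>k<d. h k) = h j * (\<Prod>k\<in>{..<d} - {j}. h k)" for h :: "nat \<Rightarrow> real"
    using j by (simp add: prod.remove)
  have integrand: "(\<Prod>i<n. weight d q m (X i)) * ((\<Sum>i<n. score m (X i) j) - 2 * (real c + 1) * m j)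
      = C * (\<Prod>k<d. g k (m k))" for m
  proof -
    have "(\<Sum>i<n. score m (X i) j) = (\<Sum>i<n. s i (m j))"
      by (intro sum.cong refl) (auto simp: score_def s_def)
    then have "(\<Prod>k<d. g k (m k)) = (\<Prod>k<d. u k (m k)) * ((\<Sum>i<n. score m (X i) j) - 2 * (real c + 1) * m j)"
      unfolding split[of "\<lambda>k. g k (m k)"] split[of "\<lambda>k. u k (m k)"] by (simp add: g_def mult_ac)
    then show ?thesis by (simp add: W mult_ac)
  qed
  have "(\<integral>p. g j p \<partial>beta_prior c) = 0"
  proof -
    define u' where "u' p = (\<Sum>i<n. a' i * (\<Prod>l\<in>{..<n} - {i}. a j l p))" for p
    have "(u j has_real_derivative u' p) (at p)" for p
    proof -
      have "(a j i has_real_derivative a' i) (at p)" for i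
        unfolding a_def a'_def by (cases "X i") (auto intro!: derivative_eq_intros)
      then show ?thesis unfolding u_def[abs_def] u'_def by (intro has_field_derivative_prod)
    qed
    moreover have "continuous_on UNIV u'" unfolding u'_def by (intro continuous_intros ca)
    ultimately have "(\<integral>p. (1 - p\<^sup>2) * u' p - 2 * (real c + 1) * p * u j p \<partial>beta_prior c) = 0"
      by (rule beta_prior_stein)
    moreover have "(1 - p\<^sup>2) * u' p = u j p * (\<Sum>i<n. s i p)" for p
    proof -
      \<comment> \<open>For a sign z, (1 - p^2) * z = (1 + p * z) * (z - p) because z^2 = 1. Thus
        \<open>1 - p\<^sup>2\<close> times the logarithmic derivative is the polynomial
        score.\<close>
      have z: "(1 - p\<^sup>2) * a' i = a j i p * s i p" if "i < n" for i
      proof (cases "X i")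
        case (Some z)
        then have "z j = 1 \<or> z j = -1" using X that j by (force simp: labels_def signs_def PiE_iff)
        then show ?thesis using Some by (auto simp: a_def a'_def s_def power2_eq_square field_simps)
      qed (simp add: a'_def s_def)
      have "(1 - p\<^sup>2) * u' p = (\<Sum>i<n. ((1 - p\<^sup>2) * a' i) * (\<Prod>l\<in>{..<n} - {i}. a j l p))"
        by (simp add: u'_def sum_distrib_left mult.assoc)
      also have "\<dots> = (\<Sum>i<n. s i p * (a j i p * (\<Prod>l\<in>{..<n} - {i}. a j l p)))"
        by (intro sum.cong refl, subst z) (simp_all add: mult_ac)
      also have "\<dots> = (\<Sum>i<n. s i p * u j p)"
        unfolding u_def by (intro sum.cong refl, subst prod.remove[of "{..<n}"]) auto
      finally show ?thesis by (simp add: mult.commute flip: sum_distrib_right)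
    qed
    ultimately show ?thesis by (simp add: g_def right_diff_distrib mult_ac)
  qed
  then have "(\<Prod>k<d. \<integral>p. g k p \<partial>beta_prior c) = 0" using j by (intro prod_zero) auto
  then show ?thesis unfolding integrand using integral_prior_prod[of d g c] cg by simp
qed

lemma measurable_weight [measurable]: "(\<lambda>m. weight d q m l) \<in> borel_measurable (euclid d)"
  unfolding weight_def sign_weight_def by (cases l) (simp, simp, measurable)

lemma measurable_score [measurable]: "j < d \<Longrightarrow> (\<lambda>m. score m l j) \<in> borel_measurable (euclid d)"
  unfolding score_def by (cases l) (simp, simp, measurable)

lemma weight_le_1:
  assumes "\<And>j. j < d \<Longrightarrow> \<bar>m j\<bar> \<le> 1" "0 \<le> q" "q \<le> 1" "l \<in> labels d"
  shows "weight d q m l \<le> 1"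
proof -
  have "weight d q m l \<le> sum (weight d q m) (labels d)"
    using assms weight_nonneg by (intro member_le_sum) (auto simp: finite_labels)
  then show ?thesis by (simp add: sum_weight)
qed

lemma abs_score_le:
  assumes "\<bar>m j\<bar> \<le> 1" "j < d" "l \<in> labels d"
  shows "\<bar>score m l j\<bar> \<le> 2"
  using assms by (force simp: score_def labels_def signs_def PiE_iff abs_le_iff)

text \<open>The vector \<open>f X\<close> depends on the data and not on m, so its coordinates are
  constant coefficients for the prior integral. The identity for each data sequence and coordinate
  then sums up by linearity; integrability follows from boundedness on the cube.\<close>

lemma prior_stein:
  fixes f :: "(nat \<Rightarrow> (nat \<Rightarrow> real) option) \<Rightarrow> nat \<Rightarrow> real" and d n c :: nat and q :: real
  assumes q: "0 \<le> q" "q \<le> 1"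
  defines "E \<equiv> \<lambda>m. iid_expect (labels d) (weight d q m) n"
  shows "integrable (prior d c) (\<lambda>m. E m (\<lambda>X. \<Sum>i<n. euclid_inner d (f X) (score m (X i))))"
    and "integrable (prior d c) (\<lambda>m. E m (\<lambda>X. euclid_inner d (f X) m))"
    and "(\<integral>m. E m (\<lambda>X. \<Sum>i<n. euclid_inner d (f X) (score m (X i))) \<partial>prior d c)
       = 2 * (real c + 1) * (\<integral>m. E m (\<lambda>X. euclid_inner d (f X) m) \<partial>prior d c)"
proof -
  let ?D = "PiE {..<n} (\<lambda>_. labels d)"
  let ?W = "\<lambda>m X. \<Prod>i<n. weight d q m (X i)"
  have finD: "finite ?D" by (intro finite_PiE finite_labels) auto
  have Wb: "\<bar>?W m X\<bar> \<le> 1" if "\<And>j. j < d \<Longrightarrow> \<bar>m j\<bar> \<le> 1" "X \<in> ?D" for m X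
  proof -
    have "X i \<in> labels d" if "i < n" for i using \<open>X \<in> ?D\<close> that by (auto simp: PiE_iff)
    then have "0 \<le> ?W m X" "?W m X \<le> 1"
      using weight_nonneg[OF that(1) q] weight_le_1[OF that(1) q] by (auto intro!: prod_nonneg prod_le_1)
    then show ?thesis by simp
  qed
  have i1: "integrable (prior d c) (\<lambda>m. ?W m X * (\<Sum>i<n. score m (X i) j))" if X: "X \<in> ?D" and j: "j < d" for X j
  proof (rule integrable_prior_bounded[where B="2 * real n"])
    show "(\<lambda>m. ?W m X * (\<Sum>i<n. score m (X i) j)) \<in> borel_measurable (euclid d)"
      using j by measurable
    fix m :: "nat \<Rightarrow> real" assume m: "\<And>j. j < d \<Longrightarrow> \<bar>m j\<bar> \<le> 1"
    have "\<bar>\<Sum>i<n. score m (X i) j\<bar> \<le> (\<Sum>i<n. 2)"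
      using X j m by (intro order_trans[OF sum_abs] sum_mono abs_score_le[of m j d]) (auto simp: PiE_iff)
    then have "\<bar>?W m X\<bar> * \<bar>\<Sum>i<n. score m (X i) j\<bar> \<le> 1 * (2 * real n)"
      using Wb[OF m X] by (intro mult_mono) auto
    then show "\<bar>?W m X * (\<Sum>i<n. score m (X i) j)\<bar> \<le> 2 * real n" by (simp add: abs_mult)
  qed
  have i2: "integrable (prior d c) (\<lambda>m. ?W m X * m j)" if X: "X \<in> ?D" and j: "j < d" for X j
  proof (rule integrable_prior_bounded[where B="1"])
    show "(\<lambda>m. ?W m X * m j) \<in> borel_measurable (euclid d)" using j by measurable
    fix m :: "nat \<Rightarrow> real" assume m: "\<And>j. j < d \<Longrightarrow> \<bar>m j\<bar> \<le> 1"
    have "\<bar>?W m X\<bar> * \<bar>m j\<bar> \<le> 1 * 1" using Wb[OF m X] m[OF j] by (intro mult_mono) auto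
    then show "\<bar>?W m X * m j\<bar> \<le> 1" by (simp add: abs_mult)
  qed
  have e1: "E m (\<lambda>X. \<Sum>i<n. euclid_inner d (f X) (score m (X i)))
      = (\<Sum>X\<in>?D. \<Sum>j<d. f X j * (?W m X * (\<Sum>i<n. score m (X i) j)))" for m
  proof -
    have "(\<Sum>i<n. euclid_inner d (f X) (score m (X i))) = (\<Sum>j<d. f X j * (\<Sum>i<n. score m (X i) j))" for X
      unfolding euclid_inner_def sum_distrib_left by (rule sum.swap)
    then show ?thesis unfolding E_def iid_expect_def by (simp only: sum_distrib_left mult.left_commute)
  qed
  have e2: "E m (\<lambda>X. euclid_inner d (f X) m) = (\<Sum>X\<in>?D. \<Sum>j<d. f X j * (?W m X * m j))" for m
    unfolding E_def iid_expect_def euclid_inner_def by (simp only: sum_distrib_left mult.left_commute)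
  show "integrable (prior d c) (\<lambda>m. E m (\<lambda>X. \<Sum>i<n. euclid_inner d (f X) (score m (X i))))"
    unfolding e1 by (intro Bochner_Integration.integrable_sum integrable_mult_right i1) auto
  show "integrable (prior d c) (\<lambda>m. E m (\<lambda>X. euclid_inner d (f X) m))"
    unfolding e2 by (intro Bochner_Integration.integrable_sum integrable_mult_right i2) auto
  have lin: "(\<integral>m. (\<Sum>X\<in>?D. \<Sum>j<d. f X j * h X j m) \<partial>prior d c)
      = (\<Sum>X\<in>?D. \<Sum>j<d. f X j * (\<integral>m. h X j m \<partial>prior d c))"
    if h: "\<And>X j. X \<in> ?D \<Longrightarrow> j < d \<Longrightarrow> integrable (prior d c) (h X j)" for h
  proof -
    have "(\<integral>m. (\<Sum>X\<in>?D. \<Sum>j<d. f X j * h X j m) \<partial>prior d c)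
      = (\<Sum>X\<in>?D. \<integral>m. (\<Sum>j<d. f X j * h X j m) \<partial>prior d c)"
      by (intro Bochner_Integration.integral_sum Bochner_Integration.integrable_sum integrable_mult_right h) auto
    also have "\<dots> = (\<Sum>X\<in>?D. \<Sum>j<d. \<integral>m. f X j * h X j m \<partial>prior d c)"
      by (intro sum.cong refl Bochner_Integration.integral_sum integrable_mult_right h) auto
    finally show ?thesis by simp
  qed
  have eq: "(\<integral>m. ?W m X * (\<Sum>i<n. score m (X i) j) \<partial>prior d c) = 2 * (real c + 1) * (\<integral>m. ?W m X * m j \<partial>prior d c)"
    if X: "X \<in> ?D" and j: "j < d" for X j
  proof -
    have "0 = (\<integral>m. ?W m X * (\<Sum>i<n. score m (X i) j) - (2 * (real c + 1)) * (?W m X * m j) \<partial>prior d c)"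
      using prior_stein_weight[OF that, where q=q and c=c] by (simp add: right_diff_distrib mult_ac)
    also have "\<dots> = (\<integral>m. ?W m X * (\<Sum>i<n. score m (X i) j) \<partial>prior d c) - 2 * (real c + 1) * (\<integral>m. ?W m X * m j \<partial>prior d c)"
      using i1[OF that] i2[OF that] by simp
    finally show ?thesis by simp
  qed
  have "(\<integral>m. E m (\<lambda>X. \<Sum>i<n. euclid_inner d (f X) (score m (X i))) \<partial>prior d c)
      = (\<Sum>X\<in>?D. \<Sum>j<d. f X j * (\<integral>m. ?W m X * (\<Sum>i<n. score m (X i) j) \<partial>prior d c))"
    unfolding e1 by (rule lin) (rule i1)
  also have "\<dots> = (\<Sum>X\<in>?D. \<Sum>j<d. f X j * (2 * (real c + 1) * (\<integral>m. ?W m X * m j \<partial>prior d c)))"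
    using eq by (intro sum.cong refl) auto
  also have "\<dots> = 2 * (real c + 1) * (\<Sum>X\<in>?D. \<Sum>j<d. f X j * (\<integral>m. ?W m X * m j \<partial>prior d c))"
    by (simp only: sum_distrib_left mult.left_commute)
  also have "(\<Sum>X\<in>?D. \<Sum>j<d. f X j * (\<integral>m. ?W m X * m j \<partial>prior d c)) = (\<integral>m. E m (\<lambda>X. euclid_inner d (f X) m) \<partial>prior d c)"
    unfolding e2 by (rule lin[symmetric]) (rule i2)
  finally show "(\<integral>m. E m (\<lambda>X. \<Sum>i<n. euclid_inner d (f X) (score m (X i))) \<partial>prior d c)
      = 2 * (real c + 1) * (\<integral>m. E m (\<lambda>X. euclid_inner d (f X) m) \<partial>prior d c)" .
qed

subsection \<open>Correlation of the output with the data\<close>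

definition data :: "nat \<Rightarrow> nat \<Rightarrow> real \<Rightarrow> (nat \<Rightarrow> (nat \<Rightarrow> real) option) \<Rightarrow> nat \<Rightarrow> nat \<Rightarrow> real" where
  "data d n R X = (\<lambda>i\<in>{..<n}. point d R (X i))"

lemma data_in_space: "data d n R X \<in> space (datasets n (euclid d))"
  by (simp add: data_def datasets_def space_PiM)

locale private_mechanism =
  fixes d n :: nat and \<epsilon> \<delta> :: real and M :: "(nat \<Rightarrow> nat \<Rightarrow> real) \<Rightarrow> (nat \<Rightarrow> real) measure" and q R \<rho> :: real
  assumes dp: "differentially_private n (euclid d) (euclid d) \<epsilon> \<delta> M"
    and eps: "0 \<le> \<epsilon>" "\<epsilon> \<le> 1" and delta: "0 \<le> \<delta>" and q: "0 \<le> q" "q \<le> 1" and R: "0 < R"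
    and rho: "0 \<le> \<rho>"
begin

abbreviation "law X \<equiv> M (data d n R X)"
abbreviation "expect m \<equiv> iid_expect (labels d) (weight d q m) n"

text \<open>Averaging over the internal randomness turns the clipped output into a deterministic
  function of the labels, the form in which Stein's identity accepts it.\<close>

definition estimate :: "(nat \<Rightarrow> (nat \<Rightarrow> real) option) \<Rightarrow> nat \<Rightarrow> real" where
  "estimate X j = (\<integral>y. clip d \<rho> y j \<partial>law X)"

lemma M_measurable: "M \<in> datasets n (euclid d) \<rightarrow>\<^sub>M prob_algebra (euclid d)"
  using dp by (simp add: differentially_private_def randomized_algorithm_def)

lemma prob_space_law: "prob_space (law X)" and sets_law [measurable_cong]: "sets (law X) = sets (euclid d)"
  using measurable_space[OF M_measurable data_in_space[of d n R X]] by (auto simp: space_prob_algebra)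

text \<open>\<open>neighbouring\<close> asks for exactly one differing entry, so labels that give
  the same data point need a case of their own, where 1 \<le> exp \<epsilon> and 0 \<le> \<delta>
  suffice.\<close>

lemma law_close:
  assumes "i < n" "A \<in> sets (euclid d)"
  shows "measure (law (X(i := l))) A \<le> exp \<epsilon> * measure (law (X(i := l'))) A + \<delta>"
proof (cases "point d R l = point d R l'")
  case True
  then have "data d n R (X(i := l)) = data d n R (X(i := l'))" by (auto simp: data_def fun_eq_iff)
  moreover have "1 * measure (law (X(i := l'))) A \<le> exp \<epsilon> * measure (law (X(i := l'))) A"
    using eps by (intro mult_right_mono) auto
  ultimately show ?thesis using delta by simp
next
  case False
  then have "{j \<in> {..<n}. data d n R (X(i := l')) j \<noteq> data d n R (X(i := l)) j} = {i}"
    using assms by (auto simp: data_def split: if_splits)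
  then have "neighbouring n (data d n R (X(i := l'))) (data d n R (X(i := l)))"
    by (simp add: neighbouring_def)
  then show ?thesis
    using dp assms(2) data_in_space unfolding differentially_private_def by blast
qed

lemma integrable_inner_clip: "integrable (law X) (\<lambda>y. euclid_inner d (clip d \<rho> y) v)"
proof -
  interpret prob_space "law X" by (rule prob_space_law)
  show ?thesis using abs_inner_clip_le[OF rho] by (intro integrable_const_bound) auto
qed

lemma integrable_clip:
  assumes "j < d"
  shows "integrable (law X) (\<lambda>y. clip d \<rho> y j)"
  using integrable_inner_clip[of X "\<lambda>i. if i = j then 1 else 0"] assms
  by (simp add: euclid_inner_def if_distrib cong: if_cong)

lemma inner_estimate: "euclid_inner d (estimate X) v = (\<integral>y. euclid_inner d (clip d \<rho> y) v \<partial>law X)"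
  unfolding euclid_inner_def estimate_def
  using integrable_clip by (subst Bochner_Integration.integral_sum) auto

lemma abs_inner_estimate_le: "\<bar>euclid_inner d (estimate X) v\<bar> \<le> \<rho> * euclid_norm d v"
proof -
  interpret prob_space "law X" by (rule prob_space_law)
  have "\<bar>euclid_inner d (estimate X) v\<bar> \<le> (\<integral>y. \<bar>euclid_inner d (clip d \<rho> y) v\<bar> \<partial>law X)"
    unfolding inner_estimate by (rule integral_abs_bound)
  also have "\<dots> \<le> (\<integral>y. \<rho> * euclid_norm d v \<partial>law X)"
    using integrable_inner_clip abs_inner_clip_le[OF rho] by (intro integral_mono) auto
  finally show ?thesis by (simp add: prob_space)
qed

text \<open>The clipped mean has norm at most \<rho> in the sense of inner products, and the summed
  score is a sum of n independent centred vectors with variance at most q per coordinate, so its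
  norm is at most sqrt (n q d) in mean square.\<close>

lemma correlation_le:
  assumes m: "\<And>j. j < d \<Longrightarrow> \<bar>m j\<bar> \<le> 1"
  shows "expect m (\<lambda>X. \<Sum>i<n. euclid_inner d (estimate X) (score m (X i))) \<le> \<rho> * sqrt (n * q * d)"
proof -
  note W = finite_labels[of d] sum_weight[of d q m]
  let ?S = "\<lambda>X j. \<Sum>i<n. score m (X i) j"
  have "expect m (\<lambda>X. \<Sum>i<n. euclid_inner d (estimate X) (score m (X i)))
      \<le> expect m (\<lambda>X. \<rho> * euclid_norm d (?S X))"
  proof (rule iid_expect_mono)
    fix X
    have "(\<Sum>i<n. euclid_inner d (estimate X) (score m (X i))) = euclid_inner d (estimate X) (?S X)"
      unfolding euclid_inner_def sum_distrib_left by (rule sum.swap)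
    also have "\<dots> \<le> \<rho> * euclid_norm d (?S X)"
      using abs_inner_estimate_le[of X "?S X"] by linarith
    finally show "(\<Sum>i<n. euclid_inner d (estimate X) (score m (X i))) \<le> \<rho> * euclid_norm d (?S X)" .
  qed (rule weight_nonneg[OF m q])
  also have "\<dots> = \<rho> * expect m (\<lambda>X. euclid_norm d (?S X))" by (rule iid_expect_cmult)
  also have "\<dots> \<le> \<rho> * sqrt (expect m (\<lambda>X. (euclid_norm d (?S X))\<^sup>2))"
    by (intro mult_left_mono iid_expect_le_sqrt W rho weight_nonneg[OF m q])
  also have "expect m (\<lambda>X. (euclid_norm d (?S X))\<^sup>2) = (\<Sum>j<d. n * (q * (1 - (m j)\<^sup>2)))"
    unfolding euclid_norm_square iid_expect_sum
  proof (intro sum.cong refl)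
    fix j assume "j \<in> {..<d}"
    then show "expect m (\<lambda>X. (\<Sum>i<n. score m (X i) j)\<^sup>2) = n * (q * (1 - (m j)\<^sup>2))"
      using iid_expect_square_sum[OF W, of "\<lambda>l. score m l j" n]
      by (simp add: sum_weight_score sum_weight_score_square)
  qed
  also have "\<rho> * sqrt \<dots> \<le> \<rho> * sqrt (\<Sum>j<d. n * (q * 1))"
    using q rho by (intro mult_left_mono real_sqrt_le_mono sum_mono) auto
  finally show ?thesis by (simp add: mult_ac)
qed

text \<open>Replacing entry \<open>i\<close> by the fixed data point \<open>0\<close> makes the output independent of that
  entry, whose score has mean zero; privacy bounds what the replacement can change.\<close>

lemma private_correlation_le:
  assumes m: "\<And>j. j < d \<Longrightarrow> \<bar>m j\<bar> \<le> 1"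
  shows "expect m (\<lambda>X. \<Sum>i<n. euclid_inner d (estimate X) (score m (X i)))
    \<le> n * (\<rho> * q * (2 * \<epsilon> + 2 * \<delta> * sqrt d))"
proof -
  note W = finite_labels[of d] sum_weight[of d q m]
  let ?w = "weight d q m"
  have w0: "0 \<le> ?w l" if "l \<in> labels d" for l using weight_nonneg[OF m q that] .
  have one: "expect m (\<lambda>X. euclid_inner d (estimate X) (score m (X i))) \<le> \<rho> * q * (2 * \<epsilon> + 2 * \<delta> * sqrt d)"
    if i: "i < n" for i
  proof -
    have "expect m (\<lambda>X. euclid_inner d (estimate X) (score m (X i)))
        = expect m (\<lambda>X. \<Sum>l\<in>labels d. ?w l * euclid_inner d (estimate (X(i := l))) (score m l))"
      by (subst iid_expect_resample[OF W i]) simp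
    also have "\<dots> \<le> expect m (\<lambda>X. \<rho> * q * (2 * \<epsilon> + 2 * \<delta> * sqrt d))"
    proof (rule iid_expect_mono[OF w0])
      fix X
      define Q where "Q = law (X(i := None))"
      interpret Q: prob_space Q unfolding Q_def by (rule prob_space_law)
      have [measurable_cong]: "sets Q = sets (euclid d)" unfolding Q_def by (rule sets_law)
      let ?\<phi> = "\<lambda>l y. euclid_inner d (clip d \<rho> y) (score m l)"
      have int: "integrable Q (?\<phi> l)" for l unfolding Q_def by (rule integrable_inner_clip)
      have inta: "integrable Q (\<lambda>y. \<bar>?\<phi> l y\<bar>)" for l using int by (rule integrable_abs)
      have "euclid_inner d (estimate (X(i := l))) (score m l)
         \<le> (\<integral>y. ?\<phi> l y \<partial>Q) + (exp \<epsilon> - 1) * (\<integral>y. \<bar>?\<phi> l y\<bar> \<partial>Q) + 2 * (\<rho> * euclid_norm d (score m l)) * \<delta>" for l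
        unfolding inner_estimate Q_def using i eps delta
        by (intro dp_integral_le[where T="euclid d"] prob_space_law sets_law law_close abs_inner_clip_le rho) auto
      then have total: "(\<Sum>l\<in>labels d. ?w l * euclid_inner d (estimate (X(i := l))) (score m l))
        \<le> (\<Sum>l\<in>labels d. ?w l * ((\<integral>y. ?\<phi> l y \<partial>Q) + (exp \<epsilon> - 1) * (\<integral>y. \<bar>?\<phi> l y\<bar> \<partial>Q)
             + 2 * (\<rho> * euclid_norm d (score m l)) * \<delta>))"
        by (intro sum_mono mult_left_mono w0)
      have expand: "(\<Sum>l\<in>labels d. ?w l * ((\<integral>y. ?\<phi> l y \<partial>Q) + (exp \<epsilon> - 1) * (\<integral>y. \<bar>?\<phi> l y\<bar> \<partial>Q)
             + 2 * (\<rho> * euclid_norm d (score m l)) * \<delta>)) = (\<Sum>l\<in>labels d. ?w l * (\<integral>y. ?\<phi> l y \<partial>Q))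
          + (exp \<epsilon> - 1) * (\<Sum>l\<in>labels d. ?w l * (\<integral>y. \<bar>?\<phi> l y\<bar> \<partial>Q))
          + 2 * \<rho> * \<delta> * (\<Sum>l\<in>labels d. ?w l * euclid_norm d (score m l))"
        by (simp add: sum_distrib_left distrib_left sum.distrib mult_ac)
      have mean0: "(\<Sum>l\<in>labels d. ?w l * (\<integral>y. ?\<phi> l y \<partial>Q)) = 0"
      proof -
        have "(\<Sum>l\<in>labels d. ?w l * (\<integral>y. ?\<phi> l y \<partial>Q)) = (\<integral>y. (\<Sum>l\<in>labels d. ?w l * ?\<phi> l y) \<partial>Q)"
          using int by simp
        also have "(\<lambda>y. \<Sum>l\<in>labels d. ?w l * ?\<phi> l y) = (\<lambda>y. 0)"
        proof
          fix y
          have "(\<Sum>l\<in>labels d. ?w l * ?\<phi> l y) = (\<Sum>l\<in>labels d. \<Sum>j<d. clip d \<rho> y j * (?w l * score m l j))"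
            unfolding euclid_inner_def by (simp only: sum_distrib_left mult.left_commute)
          also have "\<dots> = (\<Sum>j<d. clip d \<rho> y j * (\<Sum>l\<in>labels d. ?w l * score m l j))"
            unfolding sum_distrib_left by (rule sum.swap)
          finally show "(\<Sum>l\<in>labels d. ?w l * ?\<phi> l y) = 0" by (simp add: sum_weight_score)
        qed
        finally show ?thesis by simp
      qed
      \<comment> \<open>Since \<open>Q\<close> is the same for all labels, the average over
        \<open>l\<close> moves inside the integral. There the output is a fixed vector, and the
        bound for one score against a fixed vector applies.\<close>
      have "(\<Sum>l\<in>labels d. ?w l * (\<integral>y. \<bar>?\<phi> l y\<bar> \<partial>Q)) \<le> \<rho> * q"
      proof -
        have "(\<Sum>l\<in>labels d. ?w l * (\<integral>y. \<bar>?\<phi> l y\<bar> \<partial>Q)) = (\<integral>y. (\<Sum>l\<in>labels d. ?w l * \<bar>?\<phi> l y\<bar>) \<partial>Q)"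
          using inta by simp
        also have "\<dots> \<le> (\<integral>y. q * \<rho> \<partial>Q)"
        proof (rule integral_mono)
          fix y
          have "(\<Sum>l\<in>labels d. ?w l * \<bar>?\<phi> l y\<bar>) \<le> q * euclid_norm d (clip d \<rho> y)"
            by (rule sum_weight_abs_inner_score[OF m q(1)])
          also have "\<dots> \<le> q * \<rho>" by (intro mult_left_mono euclid_norm_clip rho q)
          finally show "(\<Sum>l\<in>labels d. ?w l * \<bar>?\<phi> l y\<bar>) \<le> q * \<rho>" .
        qed (use inta in auto)
        finally show ?thesis by (simp add: Q.prob_space mult.commute)
      qed
      then have "(exp \<epsilon> - 1) * (\<Sum>l\<in>labels d. ?w l * (\<integral>y. \<bar>?\<phi> l y\<bar> \<partial>Q)) \<le> (exp \<epsilon> - 1) * (\<rho> * q)"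
        using eps by (intro mult_left_mono) auto
      also have "\<dots> \<le> 2 * \<epsilon> * (\<rho> * q)"
      proof (rule mult_right_mono)
        have "\<epsilon>\<^sup>2 \<le> \<epsilon>" using eps by (simp add: power2_eq_square mult_left_le)
        then show "exp \<epsilon> - 1 \<le> 2 * \<epsilon>" using exp_bound[OF eps] by linarith
      qed (use rho q in simp)
      finally have dev: "(exp \<epsilon> - 1) * (\<Sum>l\<in>labels d. ?w l * (\<integral>y. \<bar>?\<phi> l y\<bar> \<partial>Q)) \<le> 2 * \<epsilon> * (\<rho> * q)" .
      have "2 * \<rho> * \<delta> * (\<Sum>l\<in>labels d. ?w l * euclid_norm d (score m l)) \<le> 2 * \<rho> * \<delta> * (q * sqrt d)"
        using sum_weight_norm_score[OF m q(1)] rho delta by (intro mult_left_mono) auto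
      with total expand mean0 dev
      show "(\<Sum>l\<in>labels d. ?w l * euclid_inner d (estimate (X(i := l))) (score m l))
         \<le> \<rho> * q * (2 * \<epsilon> + 2 * \<delta> * sqrt d)"
        by (simp only: distrib_left distrib_right mult_ac add_0_left)
    qed
    finally show ?thesis by (simp add: iid_expect_const[OF W])
  qed
  have "expect m (\<lambda>X. \<Sum>i<n. euclid_inner d (estimate X) (score m (X i)))
     \<le> (\<Sum>i<n. \<rho> * q * (2 * \<epsilon> + 2 * \<delta> * sqrt d))"
    unfolding iid_expect_sum by (intro sum_mono one) auto
  then show ?thesis by simp
qed

text \<open>This carries the accuracy hypothesis, a statement about \<open>output_law\<close>, over
  to a finite expectation over labels.\<close>

lemma output_law_expect:
  assumes m: "\<And>j. j < d \<Longrightarrow> \<bar>m j\<bar> \<le> 1" and A: "A \<in> sets (euclid d)"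
  shows "measure (output_law n (sparse_law d q R m) M) A = expect m (\<lambda>X. measure (law X) A)"
proof -
  let ?D = "PiE {..<n} (\<lambda>_. labels d)"
  let ?P = "point_measure ?D (\<lambda>X. ennreal (\<Prod>i<n. weight d q m (X i)))"
  have ds: "datasets n (sparse_law d q R m) = distr ?P (datasets n (euclid d)) (data d n R)"
    unfolding datasets_def sparse_law_def data_def[abs_def]
    using point_in_space by (intro PiM_distr_point_measure finite_labels weight_nonneg[OF m q] sum_weight) auto
  have ms: "sets (datasets n (sparse_law d q R m)) = sets (datasets n (euclid d))"
    unfolding datasets_def by (intro sets_PiM_cong) auto
  interpret D: prob_space "datasets n (sparse_law d q R m)"
    unfolding datasets_def by (intro prob_space_PiM prob_space_sparse_law m q)
  have finD: "finite ?D" by (intro finite_PiE finite_labels) auto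
  have Mm: "M \<in> datasets n (sparse_law d q R m) \<rightarrow>\<^sub>M subprob_algebra (euclid d)"
    using measurable_prob_algebraD[OF M_measurable] by (simp add: measurable_cong_sets[OF ms refl])
  have mm: "(\<lambda>X. measure (M X) A) \<in> borel_measurable (datasets n (euclid d))"
    using measurable_compose[OF M_measurable measurable_measure_prob_algebra[OF A]] .
  have "measure (output_law n (sparse_law d q R m) M) A = (\<integral>X. measure (M X) A \<partial>datasets n (sparse_law d q R m))"
    unfolding output_law_def by (rule D.measure_bind[OF Mm A])
  also have "\<dots> = (\<integral>X. measure (law X) A \<partial>?P)"
    unfolding ds using mm data_in_space by (intro integral_distr) auto
  also have "\<dots> = (\<Sum>X\<in>?D. (\<Prod>i<n. weight d q m (X i)) * measure (law X) A)"
    using weight_nonneg[OF m q] finD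
    by (subst lebesgue_integral_point_measure_finite) (auto intro!: prod_nonneg simp: PiE_iff)
  finally show ?thesis by (simp add: iid_expect_def)
qed

text \<open>The worst case, for those m at which accuracy cannot be invoked or tells
  nothing.\<close>

lemma expect_inner_estimate_ge:
  assumes m: "\<And>j. j < d \<Longrightarrow> \<bar>m j\<bar> \<le> 1"
  shows "- (\<rho> * euclid_norm d m) \<le> expect m (\<lambda>X. euclid_inner d (estimate X) m)"
proof -
  have "expect m (\<lambda>X. - (\<rho> * euclid_norm d m)) \<le> expect m (\<lambda>X. euclid_inner d (estimate X) m)"
    using abs_inner_estimate_le[of _ m] by (intro iid_expect_mono weight_nonneg[OF m q]) (auto simp: abs_le_iff minus_le_iff)
  then show ?thesis by (simp add: iid_expect_const[OF finite_labels sum_weight])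
qed

text \<open>An accurate output contributes at least 6 \<alpha>, any other at least -8 \<alpha>, per
  unit norm of m; with probability 2/3 of accuracy this leaves 14 * 2/3 - 8 = 4/3.\<close>

lemma accurate_expect_inner_estimate_ge:
  assumes m: "\<And>j. j < d \<Longrightarrow> \<bar>m j\<bar> \<le> 1" and \<alpha>: "0 < \<alpha>" "\<rho> = 8 * \<alpha>"
    and far: "8 * \<alpha> \<le> q * R * euclid_norm d m" and q0: "0 < q"
    and acc: "2 / 3 \<le> \<P>(y in output_law n (sparse_law d q R m) M.
       euclid_norm d (\<lambda>i. y i - (\<lambda>j\<in>{..<d}. q * R * m j) i) \<le> \<alpha>)"
  shows "4 / 3 * \<alpha> * euclid_norm d m \<le> expect m (\<lambda>X. euclid_inner d (estimate X) m)"
proof -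
  let ?\<mu> = "\<lambda>j\<in>{..<d}. q * R * m j"
  define A where "A = {y \<in> space (euclid d). euclid_norm d (\<lambda>i. y i - ?\<mu> i) \<le> \<alpha>}"
  have A[measurable]: "A \<in> sets (euclid d)" unfolding A_def by measurable
  have sp: "space (output_law n (sparse_law d q R m) M) = space (euclid d)"
  proof -
    have ms: "sets (datasets n (sparse_law d q R m)) = sets (datasets n (euclid d))"
      unfolding datasets_def by (intro sets_PiM_cong) auto
    interpret D: prob_space "datasets n (sparse_law d q R m)"
      unfolding datasets_def by (intro prob_space_PiM prob_space_sparse_law m q)
    have "sets (M X) = sets (euclid d)" if "X \<in> space (datasets n (sparse_law d q R m))" for X
      using measurable_space[OF M_measurable] that
      by (auto simp: space_prob_algebra sets_eq_imp_space_eq[OF ms])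
    then show ?thesis unfolding output_law_def using D.not_empty by (intro space_bind)
  qed
  have acc': "2 / 3 \<le> expect m (\<lambda>X. measure (law X) A)"
    using acc[unfolded sp, folded A_def] output_law_expect[OF m A] by simp
  define N where "N = euclid_norm d m"
  have N: "0 \<le> N" by (simp add: N_def euclid_norm_nonneg)
  \<comment> \<open>One affine function of the indicator encodes both cases: 14 - 8 = 6 on
    \<open>A\<close>, and -8 outside.\<close>
  have pt: "14 * \<alpha> * N * indicator A y - 8 * \<alpha> * N \<le> euclid_inner d (clip d \<rho> y) m" for y
  proof (cases "y \<in> A")
    case True
    have qR: "0 < q * R" using q0 R by simp
    have i\<mu>: "euclid_inner d v ?\<mu> = q * R * euclid_inner d v m" for v
      unfolding euclid_inner_def sum_distrib_left by (intro sum.cong) auto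
    have n\<mu>: "euclid_norm d ?\<mu> = q * R * N"
    proof -
      have "euclid_norm d ?\<mu> = euclid_norm d (\<lambda>j. q * R * m j)"
        unfolding euclid_norm_def by (rule L2_set_cong) auto
      then show ?thesis using qR euclid_norm_scale[of d "q * R" m] by (simp add: N_def)
    qed
    have "6 * \<alpha> * (q * R * N) \<le> q * R * euclid_inner d (clip d (8 * \<alpha>) y) m"
      using inner_clip_lower[of d y ?\<mu> \<alpha>] True far \<alpha> unfolding n\<mu> i\<mu> A_def by (simp add: N_def)
    then have "q * R * (6 * \<alpha> * N) \<le> q * R * euclid_inner d (clip d \<rho> y) m" using \<alpha>(2) by (simp add: mult_ac)
    then have "6 * \<alpha> * N \<le> euclid_inner d (clip d \<rho> y) m" using qR by (rule mult_left_le_imp_le)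
    then show ?thesis using True by (simp add: mult_ac)
  next
    case False
    then show ?thesis using abs_inner_clip_le[OF rho, of d y m] \<alpha>(2) by (simp add: N_def abs_le_iff)
  qed
  have "4 / 3 * \<alpha> * N \<le> 14 * \<alpha> * N * expect m (\<lambda>X. measure (law X) A) + (- 8 * \<alpha> * N)"
  proof -
    have "14 * \<alpha> * N * (2 / 3) \<le> 14 * \<alpha> * N * expect m (\<lambda>X. measure (law X) A)"
      using \<alpha> N acc' by (intro mult_left_mono) auto
    then show ?thesis by simp
  qed
  also have "\<dots> = expect m (\<lambda>X. 14 * \<alpha> * N * measure (law X) A + (- 8 * \<alpha> * N))"
    unfolding iid_expect_add iid_expect_cmult iid_expect_const[OF finite_labels sum_weight] ..
  also have "\<dots> \<le> expect m (\<lambda>X. euclid_inner d (estimate X) m)"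
  proof (rule iid_expect_mono[OF weight_nonneg[OF m q]])
    fix X
    interpret prob_space "law X" by (rule prob_space_law)
    have AM: "A \<in> sets (law X)" by (simp add: sets_law)
    have iA: "integrable (law X) (indicator A :: _ \<Rightarrow> real)" using AM by (simp add: emeasure_eq_measure)
    have "14 * \<alpha> * N * measure (law X) A + (- 8 * \<alpha> * N) = (\<integral>y. 14 * \<alpha> * N * indicator A y - 8 * \<alpha> * N \<partial>law X)"
      using iA AM sets.sets_into_space[OF AM] by (simp add: prob_space Int_absorb2)
    also have "\<dots> \<le> (\<integral>y. euclid_inner d (clip d \<rho> y) m \<partial>law X)"
      using iA integrable_inner_clip pt by (intro integral_mono) auto
    finally show "14 * \<alpha> * N * measure (law X) A + (- 8 * \<alpha> * N) \<le> euclid_inner d (estimate X) m"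
      unfolding inner_estimate .
  qed
  finally show ?thesis by (simp add: N_def)
qed

end

section \<open>Averaging accuracy over the prior\<close>

lemma sum_abs_le_euclid_norm: "(\<Sum>j<d. \<bar>m j\<bar>) \<le> sqrt d * euclid_norm d m"
  using L2_set_mult_ineq[of m "\<lambda>_. 1" "{..<d}"]
  by (simp add: euclid_norm_def L2_set_constant mult.commute)

context private_mechanism
begin

text \<open>The upper bound \<open>U\<close> is left open so that the variance bound and the privacy
  bound can both be inserted. The parameter s is the typical norm of m, and \<open>scale\<close>
  makes the corresponding displacement of the mean a large multiple of \<alpha>.\<close>

lemma correlation_bound_ge:
  assumes d: "1 \<le> d" and q0: "0 < q" and s: "0 < s" "s \<le> 1" and \<alpha>: "0 < \<alpha>" "\<rho> = 8 * \<alpha>"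
    and scale: "q * R * s = 2016 * \<alpha>"
    and acc: "\<And>m. (\<And>j. j < d \<Longrightarrow> \<bar>m j\<bar> \<le> 1) \<Longrightarrow> euclid_norm d m \<le> 126 \<Longrightarrow>
       2 / 3 \<le> \<P>(y in output_law n (sparse_law d q R m) M.
         euclid_norm d (\<lambda>i. y i - (\<lambda>j\<in>{..<d}. q * R * m j) i) \<le> \<alpha>)"
    and U: "\<And>m. (\<And>j. j < d \<Longrightarrow> \<bar>m j\<bar> \<le> 1) \<Longrightarrow>
       expect m (\<lambda>X. \<Sum>i<n. euclid_inner d (estimate X) (score m (X i))) \<le> U"
  shows "4 * \<alpha> * d / (27 * s) \<le> U"
proof -
  \<comment> \<open>With c close to d / s^2, the variance 1 / (2 c + 3) of one coordinate is of
    order s^2 / d.\<close>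
  define b where "b = real d / s\<^sup>2"
  define c where "c = nat \<lfloor>b\<rfloor>"
  have s2: "0 < s\<^sup>2" "s\<^sup>2 \<le> s" using s by (auto simp: power2_eq_square mult_left_le)
  have b: "1 \<le> b" using s2 s d by (simp add: b_def field_simps)
  then have c: "b < real c + 1" "real c \<le> b" unfolding c_def by linarith+
  define \<sigma> where "\<sigma> = 1 / sqrt (2 * real c + 3)"
  have \<sigma>: "0 < \<sigma>" by (simp add: \<sigma>_def)
  interpret P: prob_space "prior d c" by (rule prob_space_prior)
  \<comment> \<open>The mean of the norm of m has no closed form. It is bounded below through the
    sum of the |m j|, and each |m j| through this polynomial, whose mean under the prior is
    controlled.\<close>
  define h where "h p = p\<^sup>2 / \<sigma> - p ^ 4 / (4 * \<sigma> ^ 3)" for p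
  have [measurable]: "h \<in> borel_measurable borel" unfolding h_def by measurable
  define L where "L m = expect m (\<lambda>X. euclid_inner d (estimate X) m)" for m
  \<comment> \<open>An explicit minorant of \<open>L\<close> on the whole cube. The two subtracted
    terms pay for norms below s / 252 and above 126; the constants match as 252 = 7 * 36, 126 = 7 *
    18 and 2016 = 8 * 252.\<close>
  define g where "g m = 4 / 3 * \<alpha> * ((\<Sum>j<d. h (m j)) / sqrt d - s / 36 - (\<Sum>j<d. (m j)\<^sup>2) / 18)" for m
  have gL: "g m \<le> L m" if m: "\<And>j. j < d \<Longrightarrow> \<bar>m j\<bar> \<le> 1" for m
  proof -
    define N where "N = euclid_norm d m"
    have N: "0 \<le> N" by (simp add: N_def euclid_norm_nonneg)
    have "(\<Sum>j<d. h (m j)) \<le> (\<Sum>j<d. \<bar>m j\<bar>)"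
      unfolding h_def by (intro sum_mono abs_ge_quartic \<sigma>)
    also have "\<dots> \<le> sqrt d * N" unfolding N_def by (rule sum_abs_le_euclid_norm)
    finally have "(\<Sum>j<d. h (m j)) / sqrt d \<le> N" using d by (simp add: field_simps)
    then have "g m \<le> 4 / 3 * \<alpha> * (N - s / 36 - N\<^sup>2 / 18)"
      unfolding g_def N_def euclid_norm_square using \<alpha> by (intro mult_left_mono) auto
    also have "\<dots> \<le> L m"
    proof (cases "8 * \<alpha> \<le> q * R * N \<and> N \<le> 126")
      case True
      have "4 / 3 * \<alpha> * (N - s / 36 - N\<^sup>2 / 18) \<le> 4 / 3 * \<alpha> * N"
        using \<alpha> s zero_le_power2[of N] by (intro mult_left_mono) linarith+
      also have "\<dots> \<le> L m"
        unfolding L_def N_def using True \<alpha> q0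
        by (intro accurate_expect_inner_estimate_ge acc m) (auto simp: N_def)
      finally show ?thesis .
    next
      case False
      \<comment> \<open>Falling from the accurate value 4/3 * \<alpha> * N to the worst case -8 *
        \<alpha> * N costs 7 N inside the bracket, since 4/3 * (N - 7 N) = -8 N.\<close>
      have "7 * N \<le> s / 36 + N\<^sup>2 / 18"
      proof (cases "N \<le> 126")
        case True
        then have "q * R * N < 8 * \<alpha>" using False by simp
        also have "8 * \<alpha> = q * R * (s / 252)" using scale by simp
        finally have "N < s / 252" using q0 R by simp
        then show ?thesis using zero_le_power2[of N] by linarith
      next
        case False
        then have "126 * N \<le> N * N" by (intro mult_right_mono) auto
        then show ?thesis using s by (simp add: power2_eq_square)
      qed
      then have "4 / 3 * \<alpha> * (N - s / 36 - N\<^sup>2 / 18) \<le> 4 / 3 * \<alpha> * (- 6 * N)"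
        using \<alpha> by (intro mult_left_mono) auto
      also have "\<dots> = - (\<rho> * N)" using \<alpha>(2) by simp
      also have "\<dots> \<le> L m" unfolding L_def N_def by (intro expect_inner_estimate_ge m)
      finally show ?thesis .
    qed
    finally show ?thesis .
  qed
  have ih: "integrable (prior d c) (\<lambda>m. h (m j))" and i2: "integrable (prior d c) (\<lambda>m. (m j)\<^sup>2)" if "j < d" for j
  proof -
    show "integrable (prior d c) (\<lambda>m. (m j)\<^sup>2)"
      using that by (intro integrable_prior_bounded[where B=1]) (auto simp: abs_square_le_1)
    show "integrable (prior d c) (\<lambda>m. h (m j))"
    proof (rule integrable_prior_bounded[where B="1 / \<sigma> + 1 / (4 * \<sigma> ^ 3)"])
      show "(\<lambda>m. h (m j)) \<in> borel_measurable (euclid d)" using that by measurable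
      fix m :: "nat \<Rightarrow> real" assume "\<And>j. j < d \<Longrightarrow> \<bar>m j\<bar> \<le> 1"
      then have "\<bar>m j\<bar> \<le> 1" using that by simp
      then have "\<bar>m j\<bar> ^ 2 \<le> 1" "\<bar>m j\<bar> ^ 4 \<le> 1" by (intro power_le_one abs_ge_zero; assumption)+
      then have "(m j)\<^sup>2 / \<sigma> \<le> 1 / \<sigma>" "(m j) ^ 4 / (4 * \<sigma> ^ 3) \<le> 1 / (4 * \<sigma> ^ 3)"
        using \<sigma> by (auto intro!: divide_right_mono simp: power_even_abs)
      moreover have "0 \<le> (m j)\<^sup>2 / \<sigma>" "0 \<le> (m j) ^ 4 / (4 * \<sigma> ^ 3)" using \<sigma> by auto
      ultimately show "\<bar>h (m j)\<bar> \<le> 1 / \<sigma> + 1 / (4 * \<sigma> ^ 3)" unfolding h_def by linarith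
    qed
  qed
  have ig: "integrable (prior d c) g"
    unfolding g_def[abs_def] using ih i2
    by (intro integrable_mult_right Bochner_Integration.integrable_diff integrable_divide
        Bochner_Integration.integrable_sum) auto
  \<comment> \<open>As 1 \<le> b and c \<le> b, 2 c + 3 is at most 5 b; the factor 4/9 works because
    5 * (4/9)^2 = 80/81.\<close>
  have "s / 9 \<le> sqrt d * (\<sigma> / 4)"
  proof -
    have "(4 / 9 * s)\<^sup>2 * (2 * real c + 3) \<le> (4 / 9 * s)\<^sup>2 * (5 * b)"
      using c b by (intro mult_left_mono) auto
    also have "\<dots> = 80 / 81 * d" using s2 by (simp add: b_def power_mult_distrib power_divide)
    also have "\<dots> \<le> d" by simp
    finally have "(4 / 9 * s)\<^sup>2 \<le> real d / (2 * real c + 3)" by (simp add: field_simps)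
    then have "4 / 9 * s \<le> sqrt (real d / (2 * real c + 3))" by (rule real_le_rsqrt)
    then have "4 / 9 * s \<le> sqrt d * \<sigma>" by (simp add: \<sigma>_def real_sqrt_divide)
    then show ?thesis by simp
  qed
  also have "\<dots> = real d * (\<sigma> / 4) / sqrt d" using d by (simp add: field_simps)
  also have "\<dots> \<le> (\<Sum>j<d. \<integral>m. h (m j) \<partial>prior d c) / sqrt d"
  proof (rule divide_right_mono)
    have "\<sigma> / 4 \<le> (\<integral>m. h (m j) \<partial>prior d c)" if "j < d" for j
      using beta_prior_abs_lower[of c] integral_prior_component[OF that, of h c]
      unfolding \<sigma>_def[symmetric] h_def[symmetric] by simp
    then have "(\<Sum>j<d. \<sigma> / 4) \<le> (\<Sum>j<d. \<integral>m. h (m j) \<partial>prior d c)" by (intro sum_mono) auto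
    then show "real d * (\<sigma> / 4) \<le> (\<Sum>j<d. \<integral>m. h (m j) \<partial>prior d c)" by simp
  qed simp
  finally have 1: "s / 9 \<le> (\<Sum>j<d. \<integral>m. h (m j) \<partial>prior d c) / sqrt d" .
  \<comment> \<open>Here 2 c + 3 exceeds 2 b, so the second moments add up to at most s^2 / 2, hence
    to at most s / 2 because s \<le> 1.\<close>
  have 2: "(\<Sum>j<d. \<integral>m. (m j)\<^sup>2 \<partial>prior d c) / 18 \<le> s / 36"
  proof -
    have "(\<Sum>j<d. \<integral>m. (m j)\<^sup>2 \<partial>prior d c) = (\<Sum>j<d. 1 / (2 * real c + 3))"
      using integral_prior_component[of _ d "\<lambda>p. p\<^sup>2" c]
      by (intro sum.cong refl) (auto simp: beta_prior_moments)
    also have "\<dots> = d / (2 * real c + 3)" by simp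
    also have "\<dots> \<le> d / (2 * b)" using c b d by (intro divide_left_mono) auto
    also have "\<dots> = s\<^sup>2 / 2" using d s2 by (simp add: b_def)
    finally show ?thesis using s2 by simp
  qed
  define S1 S2 where "S1 m = (\<Sum>j<d. h (m j))" and "S2 m = (\<Sum>j<d. (m j)\<^sup>2)" for m
  have iS: "integrable (prior d c) S1" "integrable (prior d c) S2"
    unfolding S1_def[abs_def] S2_def[abs_def] using ih i2
    by (auto intro!: Bochner_Integration.integrable_sum)
  have S: "(\<Sum>j<d. \<integral>m. h (m j) \<partial>prior d c) = (\<integral>m. S1 m \<partial>prior d c)"
    "(\<Sum>j<d. \<integral>m. (m j)\<^sup>2 \<partial>prior d c) = (\<integral>m. S2 m \<partial>prior d c)"
    unfolding S1_def S2_def using ih i2 by (subst Bochner_Integration.integral_sum; simp)+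
  \<comment> \<open>The gain s / 9 minus the two losses of at most s / 36 each leaves s /
    18.\<close>
  have "4 / 3 * \<alpha> * (s / 18) \<le> 4 / 3 * \<alpha> * ((\<Sum>j<d. \<integral>m. h (m j) \<partial>prior d c) / sqrt d - s / 36
      - (\<Sum>j<d. \<integral>m. (m j)\<^sup>2 \<partial>prior d c) / 18)"
    using \<alpha> 1 2 by (intro mult_left_mono) auto
  also have "\<dots> = (\<integral>m. g m \<partial>prior d c)"
    unfolding g_def S S1_def[symmetric] S2_def[symmetric] using iS by (simp add: P.prob_space)
  also have "\<dots> \<le> (\<integral>m. L m \<partial>prior d c)"
    using prior_stein(2)[OF q, of d c n estimate] AE_prior[of d c] gL ig
    by (intro integral_mono_AE) (auto simp: L_def)
  finally have low: "2 * \<alpha> * s / 27 \<le> (\<integral>m. L m \<partial>prior d c)" by simp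
  \<comment> \<open>Stein's factor 2 * (c + 1) is larger than 2 b = 2 d / s^2, which turns a
    correlation of order \<alpha> * s into \<alpha> * d / s.\<close>
  have "4 * \<alpha> * d / (27 * s) = 2 * b * (2 * \<alpha> * s / 27)"
    using s by (simp add: b_def power2_eq_square mult_ac)
  also have "\<dots> \<le> 2 * (real c + 1) * (\<integral>m. L m \<partial>prior d c)"
    using low c b \<alpha> s by (intro mult_mono) auto
  also have "\<dots> = (\<integral>m. expect m (\<lambda>X. \<Sum>i<n. euclid_inner d (estimate X) (score m (X i))) \<partial>prior d c)"
    unfolding L_def by (rule prior_stein(3)[OF q, symmetric])
  also have "\<dots> \<le> (\<integral>m. U \<partial>prior d c)"
    using prior_stein(1)[OF q, of d c n estimate] AE_prior[of d c] U
    by (intro integral_mono_AE) auto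
  also have "\<dots> = U" by (simp add: P.prob_space)
  finally show ?thesis .
qed

end

section \<open>Sample size bounds for general sparsity and scale\<close>

lemma sample_bound:
  fixes s q R k \<alpha> :: real
  assumes dp: "differentially_private n (euclid d) (euclid d) \<epsilon> \<delta> M"
    and eps: "0 < \<epsilon>" "\<epsilon> \<le> 1" and delta: "0 \<le> \<delta>" "\<delta> * sqrt d \<le> \<epsilon>" and d: "1 \<le> d"
    and q: "0 < q" "q \<le> 1" and R: "0 < R" and s: "0 < s" "s \<le> 1" and \<alpha>: "0 < \<alpha>" and k: "1 \<le> k"
    and scale: "q * R * s = 2016 * \<alpha>" and qR: "q * R powr k \<le> 2016 powr k" "q * R \<le> 2016"
    and acc: "\<And>D \<mu>. prob_space D \<Longrightarrow> sets D = sets (euclid d) \<Longrightarrow> has_mean d D \<mu> \<Longrightarrow>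
        moment_bounded d k (2 powr k * (2016 powr k * (2 * k powr k * exp 127) + 254016 powr k)) D \<mu> \<Longrightarrow>
        2 / 3 \<le> \<P>(y in output_law n D M. euclid_norm d (\<lambda>i. y i - \<mu> i) \<le> \<alpha>)"
  shows "d / (2916 * s\<^sup>2) \<le> n * q" and "d / (216 * s * \<epsilon>) \<le> n * q"
proof -
  interpret mech: private_mechanism d n \<epsilon> \<delta> M q R "8 * \<alpha>"
    using assms by unfold_locales auto
  have acc': "2 / 3 \<le> \<P>(y in output_law n (sparse_law d q R m) M.
         euclid_norm d (\<lambda>i. y i - (\<lambda>j\<in>{..<d}. q * R * m j) i) \<le> \<alpha>)"
    if m: "\<And>j. j < d \<Longrightarrow> \<bar>m j\<bar> \<le> 1" and N: "euclid_norm d m \<le> 126" for m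
  proof (rule acc)
    show "prob_space (sparse_law d q R m)" "has_mean d (sparse_law d q R m) (\<lambda>j\<in>{..<d}. q * R * m j)"
      using q by (intro prob_space_sparse_law has_mean_sparse_law m; simp)+
    \<comment> \<open>The moment lemma with A = 2016 and T = 126: then T + 1 = 127 and A * T =
      254016.\<close>
    show "moment_bounded d k (2 powr k * (2016 powr k * (2 * k powr k * exp 127) + 254016 powr k))
        (sparse_law d q R m) (\<lambda>j\<in>{..<d}. q * R * m j)"
      using moment_bounded_sparse_law[of d m q R k 2016 126] m N q R k qR by simp
  qed simp
  note ge = mech.correlation_bound_ge[OF d q(1) s \<alpha> refl scale acc']
  have "4 * \<alpha> * d / (27 * s) \<le> 8 * \<alpha> * sqrt (n * q * d)"
    by (rule ge[OF _ _ mech.correlation_le])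
  then have "d / (54 * s) \<le> sqrt (n * q * d)" using \<alpha> s by (simp add: field_simps)
  then have "(d / (54 * s))\<^sup>2 \<le> n * q * d" using s by (intro sqrt_ge_absD) simp
  then show "d / (2916 * s\<^sup>2) \<le> n * q" using s d by (simp add: field_simps power2_eq_square)
  have "4 * \<alpha> * d / (27 * s) \<le> n * (8 * \<alpha> * q * (2 * \<epsilon> + 2 * \<delta> * sqrt d))"
    by (rule ge[OF _ _ mech.private_correlation_le])
  \<comment> \<open>The assumption on \<delta> makes its contribution no larger than that of
    \<epsilon>, which is the only smallness of \<delta> that the argument asks for.\<close>
  also have "\<dots> \<le> n * (8 * \<alpha> * q * (4 * \<epsilon>))"
    using \<alpha> q delta by (intro mult_left_mono) auto
  finally show "d / (216 * s * \<epsilon>) \<le> n * q" using \<alpha> s eps by (simp add: field_simps)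
qed

theorem theorem5p1:
  shows "\<exists>C1::real. C1 > 1 \<and>
    (\<forall>k::real. k \<ge> 2 \<longrightarrow>
      (\<exists>Ck c c' C C' :: real. Ck > 0 \<and> c > 0 \<and> c' > 0 \<and> C > 0 \<and> C' > 0 \<and>
        (\<forall>(d::nat) (n::nat) (\<alpha>::real) (\<epsilon>::real) (\<delta>::real) (M :: (nat \<Rightarrow> nat \<Rightarrow> real) \<Rightarrow> (nat \<Rightarrow> real) measure).
          let L = ln (2 + real d / (\<alpha> * \<epsilon>)) in
            d \<ge> 1 \<longrightarrow> n \<ge> 1 \<longrightarrow>
            0 < \<alpha> \<longrightarrow> \<alpha> \<le> 1 \<longrightarrow> 0 < \<epsilon> \<longrightarrow> \<epsilon> \<le> 1 \<longrightarrow>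
            0 \<le> \<delta> \<longrightarrow> \<delta> \<le> (c' / L powr C' * (\<alpha> * \<epsilon> / real d)) powr C1 \<longrightarrow>
            differentially_private n (euclid d) (euclid d) \<epsilon> \<delta> M \<longrightarrow>
            (\<forall>D \<mu>. prob_space D \<longrightarrow> sets D = sets (euclid d) \<longrightarrow>
               has_mean d D \<mu> \<longrightarrow> moment_bounded d k Ck D \<mu> \<longrightarrow>
               \<P>(y in output_law n D M. euclid_norm d (\<lambda>i. y i - \<mu> i) \<le> \<alpha>) \<ge> 2 / 3) \<longrightarrow>
            real n \<ge> c / L powr C *
              (real d / \<alpha>\<^sup>2 + real d / (\<alpha> powr (k / (k - 1)) * \<epsilon>)))))"
proof (rule exI[of _ 2], intro conjI allI impI)
  fix k :: real assume k: "2 \<le> k"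
  \<comment> \<open>The moment constant of \<open>sample_bound\<close>; it serves both choices of
    parameters below.\<close>
  define Ck where "Ck = 2 powr k * (2016 powr k * (2 * k powr k * exp 127) + 254016 powr k)"
  have Ck: "0 < Ck" using k unfolding Ck_def by (intro mult_pos_pos add_pos_pos) auto
  have bound: "1 / 5832 / L powr 1 * (real d / \<alpha>\<^sup>2 + real d / (\<alpha> powr (k / (k - 1)) * \<epsilon>)) \<le> real n"
    if L: "L = ln (2 + real d / (\<alpha> * \<epsilon>))" and d: "1 \<le> d" and \<alpha>: "0 < \<alpha>" "\<alpha> \<le> 1" and \<epsilon>: "0 < \<epsilon>" "\<epsilon> \<le> 1"
      and \<delta>: "0 \<le> \<delta>" "\<delta> \<le> (1 / L powr 1 * (\<alpha> * \<epsilon> / real d)) powr 2"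
      and dp: "differentially_private n (euclid d) (euclid d) \<epsilon> \<delta> M"
      and acc: "\<forall>D \<mu>. prob_space D \<longrightarrow> sets D = sets (euclid d) \<longrightarrow>
               has_mean d D \<mu> \<longrightarrow> moment_bounded d k Ck D \<mu> \<longrightarrow>
               \<P>(y in output_law n D M. euclid_norm d (\<lambda>i. y i - \<mu> i) \<le> \<alpha>) \<ge> 2 / 3"
    for d n :: nat and \<alpha> \<epsilon> \<delta> L :: real and M
  proof -
    have \<alpha>\<epsilon>: "0 < \<alpha> * \<epsilon>" "\<alpha> * \<epsilon> \<le> \<epsilon>" "\<alpha> * \<epsilon> \<le> 1"
      using \<alpha> \<epsilon> by (auto simp: mult_left_le_one_le intro: mult_le_one)
    \<comment> \<open>From L \<ge> 1, dividing by L only weakens the conclusion and only strengthens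
      the condition on \<delta>.\<close>
    have L1: "1 \<le> L"
    proof -
      have "exp 1 \<le> (3 :: real)" by (rule exp_le)
      also have "3 \<le> 2 + real d / (\<alpha> * \<epsilon>)" using d \<alpha>\<epsilon> by (simp add: le_divide_eq)
      finally show ?thesis unfolding L using d \<alpha>\<epsilon> by (subst ln_ge_iff) (auto intro!: add_pos_nonneg)
    qed
    \<comment> \<open>With exponent 2 and unit constants, \<delta> \<le> x^2 \<le> x \<le>
      \<epsilon> / d, because x lies in (0, 1].\<close>
    have small: "\<delta> * sqrt d \<le> \<epsilon>"
    proof -
      define x where "x = 1 / L powr 1 * (\<alpha> * \<epsilon> / real d)"
      have "x \<le> 1 * (\<alpha> * \<epsilon> / real d)"
        unfolding x_def using L1 \<alpha>\<epsilon> d by (intro mult_right_mono) auto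
      also have "\<dots> \<le> \<epsilon> / real d" using \<alpha>\<epsilon> by (simp add: divide_right_mono)
      finally have x: "x \<le> \<epsilon> / real d" .
      have x0: "0 < x" unfolding x_def using L1 \<alpha> \<epsilon> d by simp
      have "\<epsilon> / real d \<le> 1" using d \<epsilon> by (simp add: divide_le_eq)
      then have "x powr 2 \<le> x powr 1" using x x0 by (intro powr_mono') auto
      then have "\<delta> \<le> \<epsilon> / real d" using \<delta>(2) x x0 unfolding x_def[symmetric] by simp
      then have "\<delta> * sqrt d \<le> \<epsilon> / real d * sqrt d" by (intro mult_right_mono) auto
      also have "\<dots> \<le> \<epsilon> / real d * real d"
        using d \<epsilon> by (intro mult_left_mono) (auto simp: sqrt_le_D real_le_lsqrt power2_eq_square)
      finally show ?thesis using d by simp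
    qed
    note sb = sample_bound[OF dp \<epsilon> \<delta>(1) small d _ _ _ _ _ \<alpha>(1), of _ _ _ k]
    \<comment> \<open>No sparsity: q = 1 and R = 2016, with the prior concentrated at scale s =
      \<alpha>.\<close>
    have A: "d / (2916 * \<alpha>\<^sup>2) \<le> n"
      using sb(1)[of 1 2016 \<alpha>] \<alpha> k acc by (simp add: Ck_def)
    \<comment> \<open>For s = 1 these are the solutions of q * R = 2016 * \<alpha> and q * R powr k
      = 2016 powr k: rare points, as far out as the moment bound permits.\<close>
    define q where "q = \<alpha> powr (k / (k - 1))"
    define R where "R = 2016 * \<alpha> powr (- 1 / (k - 1))"
    have q: "0 < q" "q \<le> 1" using \<alpha> k by (auto simp: q_def intro!: powr_le1)
    have qR: "q * R = 2016 * \<alpha>"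
    proof -
      have "k / (k - 1) + - 1 / (k - 1) = (k + - 1) / (k - 1)"
        by (rule add_divide_distrib[symmetric])
      then have "k / (k - 1) + - 1 / (k - 1) = 1" using k by simp
      then have "\<alpha> powr (k / (k - 1)) * \<alpha> powr (- 1 / (k - 1)) = \<alpha>"
        using \<alpha> by (simp flip: powr_add)
      then show ?thesis by (simp add: q_def R_def)
    qed
    have qRk: "q * R powr k = 2016 powr k"
    proof -
      have "k / (k - 1) + - 1 / (k - 1) * k = 0" using k by (simp add: field_simps)
      then have "\<alpha> powr (k / (k - 1)) * (\<alpha> powr (- 1 / (k - 1))) powr k = 1"
        using \<alpha> unfolding powr_powr by (simp flip: powr_add)
      then show ?thesis by (simp add: q_def R_def powr_mult)
    qed
    have "d / (216 * \<epsilon>) \<le> n * q"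
      using sb(2)[of q R 1] q qR qRk \<alpha> k acc by (simp add: Ck_def R_def)
    then have B: "d / (216 * (q * \<epsilon>)) \<le> n" using q \<epsilon> by (simp add: field_simps)
    \<comment> \<open>The constant is chosen as 5832 = 2 * 2916 = 27 * 216, so the two terms cost n
      / 2 and n / 27.\<close>
    have "1 / 5832 / L powr 1 * (real d / \<alpha>\<^sup>2 + real d / (q * \<epsilon>)) \<le> 1 / 5832 * (real d / \<alpha>\<^sup>2 + real d / (q * \<epsilon>))"
      using L1 q \<epsilon> by (intro mult_right_mono) (auto simp: divide_le_eq)
    also have "\<dots> = (d / (2916 * \<alpha>\<^sup>2)) / 2 + (d / (216 * (q * \<epsilon>))) / 27"
      by simp
    also have "\<dots> \<le> n / 2 + n / 27" using A B by (intro add_mono divide_right_mono) auto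
    also have "\<dots> \<le> n" by simp
    finally show ?thesis by (simp add: q_def)
  qed
  show "\<exists>Ck c c' C C' :: real. Ck > 0 \<and> c > 0 \<and> c' > 0 \<and> C > 0 \<and> C' > 0 \<and>
        (\<forall>(d::nat) (n::nat) (\<alpha>::real) (\<epsilon>::real) (\<delta>::real) (M :: (nat \<Rightarrow> nat \<Rightarrow> real) \<Rightarrow> (nat \<Rightarrow> real) measure).
          let L = ln (2 + real d / (\<alpha> * \<epsilon>)) in
            d \<ge> 1 \<longrightarrow> n \<ge> 1 \<longrightarrow>
            0 < \<alpha> \<longrightarrow> \<alpha> \<le> 1 \<longrightarrow> 0 < \<epsilon> \<longrightarrow> \<epsilon> \<le> 1 \<longrightarrow>
            0 \<le> \<delta> \<longrightarrow> \<delta> \<le> (c' / L powr C' * (\<alpha> * \<epsilon> / real d)) powr 2 \<longrightarrow>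
            differentially_private n (euclid d) (euclid d) \<epsilon> \<delta> M \<longrightarrow>
            (\<forall>D \<mu>. prob_space D \<longrightarrow> sets D = sets (euclid d) \<longrightarrow>
               has_mean d D \<mu> \<longrightarrow> moment_bounded d k Ck D \<mu> \<longrightarrow>
               \<P>(y in output_law n D M. euclid_norm d (\<lambda>i. y i - \<mu> i) \<le> \<alpha>) \<ge> 2 / 3) \<longrightarrow>
            real n \<ge> c / L powr C *
              (real d / \<alpha>\<^sup>2 + real d / (\<alpha> powr (k / (k - 1)) * \<epsilon>)))"
  proof (rule exI[of _ Ck], rule exI[of _ "1 / 5832"], rule exI[of _ 1], rule exI[of _ 1], rule exI[of _ 1],
      unfold Let_def, intro conjI allI impI)
    show "0 < Ck" by (rule Ck)
  qed (simp, simp, simp, simp, rule bound[OF refl])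
qed simp

end
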